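(* Let $G$ be a finite $Q_8$-free group such that any subgroup of $G$ with order $2$ is an $IC\Phi$-subgroup of $G$. Then $G$ is $2$-nilpotent.
   Context: All groups are finite. For a group $G$ and a subgroup $H \le G$, $[H,G]$ denotes the subgroup generated by all commutators $[h,g]$ with $h \in H$, $g \in G$, and $\Phi(H)$ denotes the Frattini subgroup of $H$ (the intersection of all maximal subgroups of $H$, with $\Phi(1)=1$). A subgroup $H$ of $G$ is an $IC\Phi$-subgroup of $G$ if $H \cap [H,G] \le \Phi(H)$. $Q_8$ is the quaternion group of order $8$. A group $G$ is $Q_8$-free if no section of $G$ (i.e. no quotient $A/B$ with $B \trianglelefteq A \le G$) is isomorphic to $Q_8$. For a prime $p$, a group $G$ is $p$-nilpotent if it has a normal $p'$-subgroup $N$ (order coprime to $p$) such that $G/N$ is a $p$-group. *)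

theory Defs
  imports "HOL-Algebra.Algebra"
begin

text \<open>The library's \<^const>\<open>derived\<close> is the diagonal case \<open>[H, H]\<close>; we keep its convention
  \<open>[h, k] = h k h\<inverse> k\<inverse>\<close>. As \<open>H\<close> and \<open>K\<close> are closed under inverses whenever they are subgroups,
  the convention \<open>h\<inverse> k\<inverse> h k\<close> generates the same subgroup.\<close>

definition commutator_subgroup :: "('a, 'b) monoid_scheme \<Rightarrow> 'a set \<Rightarrow> 'a set \<Rightarrow> 'a set" where
  "commutator_subgroup G H K =
     generate G (\<Union>h\<in>H. \<Union>k\<in>K. {h \<otimes>\<^bsub>G\<^esub> k \<otimes>\<^bsub>G\<^esub> (inv\<^bsub>G\<^esub> h) \<otimes>\<^bsub>G\<^esub> (inv\<^bsub>G\<^esub> k)})"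

definition maximal_subgroup :: "'a set \<Rightarrow> ('a, 'b) monoid_scheme \<Rightarrow> bool" where
  "maximal_subgroup M G \<longleftrightarrow>
     subgroup M G \<and> M \<noteq> carrier G \<and>
     (\<forall>K. subgroup K G \<longrightarrow> M \<subseteq> K \<longrightarrow> K = M \<or> K = carrier G)"

text \<open>Intersecting with the carrier matters only if there is no maximal subgroup. Among finite
  groups this is the trivial group, which then is its own Frattini subgroup.\<close>

definition frattini :: "('a, 'b) monoid_scheme \<Rightarrow> 'a set" where
  "frattini G = carrier G \<inter> \<Inter>{M. maximal_subgroup M G}"

definition ic_phi_subgroup :: "'a set \<Rightarrow> ('a, 'b) monoid_scheme \<Rightarrow> bool" where
  "ic_phi_subgroup H G \<longleftrightarrow>
     subgroup H G \<and>
     H \<inter> commutator_subgroup G H (carrier G) \<subseteq> frattini (G\<lparr>carrier := H\<rparr>)"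

text \<open>\<open>(a, b, c, d)\<close> stands for the quaternion \<open>a + b i + c j + d k\<close>; the operation is
  Hamilton's product and \<open>Q8\<close> consists of \<open>\<plusminus>1, \<plusminus>i, \<plusminus>j, \<plusminus>k\<close>.\<close>

fun hamilton_mult :: "int \<times> int \<times> int \<times> int \<Rightarrow> int \<times> int \<times> int \<times> int \<Rightarrow> int \<times> int \<times> int \<times> int" where
  "hamilton_mult (a, b, c, d) (a', b', c', d') =
     (a * a' - b * b' - c * c' - d * d',
      a * b' + b * a' + c * d' - d * c',
      a * c' - b * d' + c * a' + d * b',
      a * d' + b * c' - c * b' + d * a')"

definition Q8 :: "(int \<times> int \<times> int \<times> int) monoid" where
  "Q8 = \<lparr>carrier = {(1, 0, 0, 0), (-1, 0, 0, 0), (0, 1, 0, 0), (0, -1, 0, 0),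
                    (0, 0, 1, 0), (0, 0, -1, 0), (0, 0, 0, 1), (0, 0, 0, -1)},
         monoid.mult = hamilton_mult, one = (1, 0, 0, 0)\<rparr>"

lemma group_Q8: "group Q8"
proof (rule groupI)
  fix x y z
  show "x \<otimes>\<^bsub>Q8\<^esub> y \<otimes>\<^bsub>Q8\<^esub> z = x \<otimes>\<^bsub>Q8\<^esub> (y \<otimes>\<^bsub>Q8\<^esub> z)"
    by (cases x; cases y; cases z) (simp add: Q8_def algebra_simps)
next
  fix x assume "x \<in> carrier Q8"
  then show "\<exists>y\<in>carrier Q8. y \<otimes>\<^bsub>Q8\<^esub> x = \<one>\<^bsub>Q8\<^esub>"
    by (auto simp: Q8_def)
qed (auto simp: Q8_def)

lemma order_Q8: "order Q8 = 8"
  by (simp add: order_def Q8_def)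

definition Q8_free :: "('a, 'b) monoid_scheme \<Rightarrow> bool" where
  "Q8_free G \<longleftrightarrow>
     (\<forall>A B. subgroup A G \<longrightarrow> B \<lhd> G\<lparr>carrier := A\<rparr> \<longrightarrow> \<not> (G\<lparr>carrier := A\<rparr> Mod B \<cong> Q8))"

text \<open>Intended for finite groups and prime \<open>p\<close>.\<close>

definition p_nilpotent :: "nat \<Rightarrow> ('a, 'b) monoid_scheme \<Rightarrow> bool" where
  "p_nilpotent p G \<longleftrightarrow>
     (\<exists>N. N \<lhd> G \<and> coprime (card N) p \<and> (\<exists>n. order (G Mod N) = p ^ n))"

end

theory Submission
  imports Defs
begin

text \<open>
  For an involution \<open>t\<close>, the hypothesis on \<open>\<langle>t\<rangle>\<close> says that \<open>t\<close> lies outside the normal subgroup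
  \<open>[\<langle>t\<rangle>, G]\<close>. In this form the hypothesis passes to subgroups and to quotients by normal subgroups of
  odd order, and so does the absence of \<open>Q\<^sub>8\<close>-sections. Hence in a counterexample \<open>G\<close> of minimal order
  every proper subgroup is 2-nilpotent and no nontrivial normal subgroup has odd order; then every
  proper normal subgroup is a 2-group, and \<open>G\<close> has no normal subgroup of index 2.

  If every normal 2-subgroup of \<open>G\<close> were central, the normalizer of each noncentral 2-subgroup would be
  proper, hence 2-nilpotent, and a Sylow 2-subgroup \<open>T\<close> would control its own fusion. The transfer
  into \<open>T / K\<close>, where \<open>K\<close> has index 2 in \<open>T\<close>, would then produce a normal subgroup of index 2.

  So some normal 2-subgroup \<open>P\<close> is not centralized by some \<open>x\<close> of odd order, and \<open>G = P\<langle>x\<rangle>\<close>. All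
  normal subgroups of \<open>G\<close> properly contained in \<open>P\<close> are central, and the hypothesis on involutions
  makes \<open>x\<close> commute with all involutions of \<open>P\<close>. Squares and commutators of elements of \<open>P\<close> are
  central. If \<open>x\<close> does not commute with \<open>g \<in> P\<close>, put \<open>i = g (x g x\<inverse>)\<inverse>\<close>, \<open>j = x i x\<inverse>\<close>, \<open>s = i\<^sup>2\<close> and
  \<open>z = [i, j]\<close>. Then \<open>s = j\<^sup>2\<close> and \<open>z\<close> are central of order 2, and \<open>\<langle>i, j\<rangle> / \<langle>s z\<rangle>\<close> is a quaternion group.
\<close>

section \<open>Elementary facts and normal 2-complements\<close>

context group
begin

lemma inv_mult_cancel_left: "x \<in> carrier G \<Longrightarrow> y \<in> carrier G \<Longrightarrow> inv x \<otimes> (x \<otimes> y) = y"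
  by (simp flip: m_assoc)

lemma mult_inv_cancel_left: "x \<in> carrier G \<Longrightarrow> y \<in> carrier G \<Longrightarrow> x \<otimes> (inv x \<otimes> y) = y"
  by (simp flip: m_assoc)

lemmas group_word = m_assoc inv_mult_group inv_mult_cancel_left mult_inv_cancel_left

lemma conj_nat_pow:
  assumes "g \<in> carrier G" "x \<in> carrier G"
  shows "(g \<otimes> x \<otimes> inv g) [^] (n::nat) = g \<otimes> x [^] n \<otimes> inv g"
  using assms by (induct n) (simp_all add: group_word)

lemma ord_conj:
  assumes "g \<in> carrier G" "x \<in> carrier G"
  shows "ord (g \<otimes> x \<otimes> inv g) = ord x"
proof -
  have "(g \<otimes> x \<otimes> inv g) [^] n = \<one> \<longleftrightarrow> x [^] n = \<one>" for n :: nat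
    using assms by (simp add: conj_nat_pow inv_solve_right')
  then show ?thesis
    using assms by (simp add: ord_unique pow_eq_id)
qed

lemma conj_eq_iff_commute:
  assumes "g \<in> carrier G" "x \<in> carrier G"
  shows "g \<otimes> x \<otimes> inv g = x \<longleftrightarrow> g \<otimes> x = x \<otimes> g"
  using assms by (simp add: inv_solve_right')

lemma commute_inv:
  assumes "x \<in> carrier G" "y \<in> carrier G" "x \<otimes> y = y \<otimes> x"
  shows "inv x \<otimes> y = y \<otimes> inv x"
proof -
  have "inv x \<otimes> y = inv x \<otimes> (y \<otimes> x) \<otimes> inv x"
    using assms(1,2) by (simp add: m_assoc)
  also have "\<dots> = y \<otimes> inv x"
    using assms(1,2) by (simp add: inv_mult_cancel_left flip: assms(3))
  finally show ?thesis .
qed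

lemma subgroup_pow_card:
  assumes "subgroup N G" "x \<in> N"
  shows "x [^] card N = \<one>"
proof -
  interpret N: group "G\<lparr>carrier := N\<rparr>"
    using assms(1) by (rule subgroup_imp_group)
  show ?thesis
    using N.pow_order_eq_1[of x] assms by (simp add: order_def flip: nat_pow_consistent)
qed

lemma ord_dvd_card_subgroup:
  assumes "subgroup N G" "x \<in> N"
  shows "ord x dvd card N"
  using assms subgroup_pow_card by (metis pow_eq_id subgroup.mem_carrier)

lemma odd_ord_two_pow_trivial:
  assumes "subgroup P G" "card P = 2 ^ k" "x \<in> P" "odd (ord x)"
  shows "x = \<one>"
proof -
  have "ord x dvd 2 ^ k"
    using ord_dvd_card_subgroup[of P x] assms by simp
  then obtain i where "ord x = 2 ^ i"
    using divides_primepow_nat[OF two_is_prime_nat] by blast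
  then have "ord x = 1"
    using assms(4) by (cases i) auto
  then show ?thesis
    using assms ord_eq_1[of x] subgroup.mem_carrier[of P G x] by simp
qed

lemma odd_card_subgroup_odd_ord:
  assumes "subgroup N G" "odd (card N)" "x \<in> N"
  shows "odd (ord x)"
  using assms ord_dvd_card_subgroup dvd_trans by blast

lemma subgroup_nat_pow_closed:
  assumes "subgroup H G" "x \<in> H"
  shows "x [^] (n::nat) \<in> H"
  using assms by (induct n) (auto simp: subgroup.one_closed subgroup.m_closed)

text \<open>By Lagrange the quotient by \<open>N\<close> has order \<open>m\<close>, so the coset of
  \<open>x\<close> becomes trivial when raised to the power \<open>m\<close>.\<close>

lemma normal_quotient_pow:
  assumes "N \<lhd> G" "finite (carrier G)" "order G = card N * m" "x \<in> carrier G"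
  shows "x [^] m \<in> N"
proof -
  interpret N: normal N G by fact
  interpret Q: group "G Mod N" by (rule N.factorgroup_is_group)
  have "card N > 0"
    using assms(2) N.subset N.one_closed by (metis card_gt_0_iff empty_iff finite_subset)
  moreover have "card (rcosets N) * card N = order G"
    by (rule lagrange[OF N.subgroup_axioms])
  ultimately have "order (G Mod N) = m"
    using assms(3) by (simp add: order_def FactGroup_def)
  moreover have "N #> x \<in> carrier (G Mod N)"
    using assms(4) by (auto simp: FactGroup_def RCOSETS_def)
  ultimately have "N #> (x [^] m) = N"
    using Q.pow_order_eq_1 N.FactGroup_pow[OF assms(4)] by (metis one_FactGroup)
  then show ?thesis
    using assms(4) coset_join1[OF _ _ N.subgroup_axioms] by simp
qed

text \<open>The number \<open>2 ^ k\<close> is invertible modulo the odd order of \<open>x\<close>,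
  so a Bezout coefficient undoes the power.\<close>

lemma odd_ord_pow_inverse:
  assumes "x \<in> carrier G" "odd (ord x)"
  shows "\<exists>j. (x [^] ((2::nat) ^ k)) [^] (j::nat) = x"
proof -
  obtain j y where "2 ^ k * j = ord x * y + gcd (2 ^ k) (ord x)"
    using bezout_nat[of "2 ^ k" "ord x"] by auto
  moreover have "gcd (2 ^ k) (ord x) = 1"
    using assms(2) by (simp flip: coprime_iff_gcd_eq_1)
  ultimately have "x [^] (2 ^ k * j) = x [^] (ord x * y) \<otimes> x"
    by simp
  also have "\<dots> = x"
    using assms(1) pow_eq_id[of x "ord x * y"] by simp
  finally show ?thesis
    using assms(1) by (auto simp: nat_pow_pow)
qed

end

text \<open>All conditions are phrased in the ambient \<open>G\<close>, with \<open>H\<close> a mere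
  set, so that no group with restricted carrier has to be handled. The last conjunct says that the
  index of \<open>N\<close> in \<open>H\<close> is a power of 2.\<close>

definition normal_two_complement :: "('a, 'b) monoid_scheme \<Rightarrow> 'a set \<Rightarrow> 'a set \<Rightarrow> bool" where
  "normal_two_complement G H N \<longleftrightarrow>
     subgroup N G \<and> N \<subseteq> H \<and> (\<forall>h\<in>H. \<forall>n\<in>N. h \<otimes>\<^bsub>G\<^esub> n \<otimes>\<^bsub>G\<^esub> inv\<^bsub>G\<^esub> h \<in> N) \<and> odd (card N) \<and>
     (\<exists>k. card H = card N * 2 ^ k)"

context group
begin

lemma p_nilpotent_two_subgroup_iff:
  assumes "finite (carrier G)" "subgroup H G"
  shows "p_nilpotent 2 (G\<lparr>carrier := H\<rparr>) \<longleftrightarrow> (\<exists>N. normal_two_complement G H N)"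
proof -
  interpret H: group "G\<lparr>carrier := H\<rparr>"
    using assms(2) by (rule subgroup_imp_group)
  have "N \<lhd> G\<lparr>carrier := H\<rparr> \<longleftrightarrow> subgroup N G \<and> N \<subseteq> H \<and> (\<forall>h\<in>H. \<forall>n\<in>N. h \<otimes> n \<otimes> inv h \<in> N)" for N
  proof -
    have "subgroup N (G\<lparr>carrier := H\<rparr>) \<longleftrightarrow> subgroup N G \<and> N \<subseteq> H"
      using subgroup_incl[OF _ assms(2), of N] incl_subgroup[OF assms(2), of N]
        subgroup.subset[of N "G\<lparr>carrier := H\<rparr>"] by auto
    then show ?thesis
      using assms(2) by (simp add: H.normal_inv_iff)
  qed
  moreover have "(\<exists>k. order (G\<lparr>carrier := H\<rparr> Mod N) = 2 ^ k) \<longleftrightarrow> (\<exists>k. card H = card N * 2 ^ k)"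
    if "N \<lhd> G\<lparr>carrier := H\<rparr>" for N
  proof -
    interpret N: normal N "G\<lparr>carrier := H\<rparr>" by fact
    have "finite N"
      using N.subset assms(1) subgroup.subset[OF assms(2)] by (auto intro: finite_subset)
    then have "card N > 0"
      using N.one_closed by (auto simp: card_gt_0_iff)
    moreover have "card (rcosets\<^bsub>G\<lparr>carrier := H\<rparr>\<^esub> N) * card N = card H"
      using H.lagrange[OF N.subgroup_axioms] by (simp add: order_def)
    ultimately show ?thesis
      by (auto simp: order_def FactGroup_def simp flip: \<open>_ = card H\<close>)
  qed
  ultimately show ?thesis
    unfolding p_nilpotent_def normal_two_complement_def by (simp add: conj_assoc) (metis (no_types, lifting))
qed

lemma p_nilpotent_two_iff:
  assumes "finite (carrier G)"
  shows "p_nilpotent 2 G \<longleftrightarrow> (\<exists>N. normal_two_complement G (carrier G) N)"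
  using p_nilpotent_two_subgroup_iff[OF assms subgroup_self] by simp

text \<open>The 2-power index puts \<open>x [^] (2 ^ k)\<close> into \<open>N\<close>, and an
  \<open>x\<close> of odd order is a power of that element. Hence the complement is determined by
  \<open>H\<close>, a description that is stable under conjugation.\<close>

lemma normal_two_complement_mem_iff:
  assumes "finite (carrier G)" "subgroup H G" "normal_two_complement G H N" "x \<in> H"
  shows "x \<in> N \<longleftrightarrow> odd (ord x)"
proof
  show "odd (ord x)" if "x \<in> N"
    using assms(3) that odd_card_subgroup_odd_ord by (auto simp: normal_two_complement_def)
  assume odd: "odd (ord x)"
  interpret H: group "G\<lparr>carrier := H\<rparr>"
    using assms(2) by (rule subgroup_imp_group)
  have N: "subgroup N G" "N \<subseteq> H" "\<forall>h\<in>H. \<forall>n\<in>N. h \<otimes> n \<otimes> inv h \<in> N"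
    using assms(3) by (auto simp: normal_two_complement_def)
  obtain k where k: "card H = card N * 2 ^ k"
    using assms(3) by (auto simp: normal_two_complement_def)
  have "N \<lhd> G\<lparr>carrier := H\<rparr>"
    using N assms(2) subgroup_incl by (auto simp: H.normal_inv_iff)
  moreover have "finite H"
    using assms finite_subset subgroup.subset by blast
  ultimately have "x [^] (2::nat) ^ k \<in> N"
    using H.normal_quotient_pow[of N "2 ^ k" x] k assms(4)
    by (simp add: order_def flip: nat_pow_consistent)
  moreover obtain j where "(x [^] (2::nat) ^ k) [^] (j::nat) = x"
    using odd_ord_pow_inverse[OF _ odd] subgroup.mem_carrier[OF assms(2,4)] by blast
  ultimately show "x \<in> N"
    using subgroup_nat_pow_closed[OF N(1), of "x [^] (2::nat) ^ k" j] by simp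
qed

text \<open>The commutator of \<open>a\<close> and \<open>b\<close> is a product of two elements of
  \<open>N\<close> and also a product of two elements of \<open>M\<close>. Normality enters only
  through the two conjugates at hand.\<close>

lemma normal_subgroups_commute:
  assumes "subgroup M G" "subgroup N G" "M \<inter> N \<subseteq> {\<one>}"
    and "a \<in> M" "b \<in> N" "b \<otimes> a \<otimes> inv b \<in> M" "a \<otimes> b \<otimes> inv a \<in> N"
  shows "a \<otimes> b = b \<otimes> a"
proof -
  have c: "a \<in> carrier G" "b \<in> carrier G"
    using subgroup.mem_carrier[OF assms(1,4)] subgroup.mem_carrier[OF assms(2,5)] .
  have "a \<otimes> b \<otimes> inv a \<otimes> inv b \<in> N"
    using assms(2,5,7) by (simp add: subgroup.m_closed subgroup.m_inv_closed)
  moreover have "a \<otimes> inv (b \<otimes> a \<otimes> inv b) \<in> M"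
    using assms(1,4,6) by (simp add: subgroup.m_closed subgroup.m_inv_closed)
  moreover have "a \<otimes> inv (b \<otimes> a \<otimes> inv b) = a \<otimes> b \<otimes> inv a \<otimes> inv b"
    using c by (simp add: group_word)
  ultimately have "a \<otimes> b \<otimes> inv a \<otimes> inv b = \<one>"
    using assms(3) by auto
  then show ?thesis
    using c by (simp add: inv_solve_right')
qed

lemma odd_and_two_subgroups_disjoint:
  assumes "subgroup N G" "odd (card N)" "subgroup P G" "card P = 2 ^ k"
  shows "N \<inter> P \<subseteq> {\<one>}"
  using assms odd_ord_two_pow_trivial odd_card_subgroup_odd_ord by blast

text \<open>A choice on left cosets that depends only on the coset. The range of \<open>r\<close>
  serves as the coset space inside the carrier, for actions, for the transfer and for
  quotients.\<close>

lemma coset_representatives: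
  assumes "subgroup H G"
  obtains r where "\<And>g. g \<in> carrier G \<Longrightarrow> r g \<in> carrier G"
    and "\<And>g h. g \<in> carrier G \<Longrightarrow> h \<in> carrier G \<Longrightarrow> r g = r h \<longleftrightarrow> inv g \<otimes> h \<in> H"
    and "\<And>g. g \<in> carrier G \<Longrightarrow> r (r g) = r g"
proof
  define r where "r g = (SOME y. y \<in> g <# H)" for g
  have r: "r g \<in> g <# H" if "g \<in> carrier G" for g
    unfolding r_def by (rule someI_ex) (use assms subgroup.one_closed in \<open>force simp: l_coset_def\<close>)
  show c: "r g \<in> carrier G" if "g \<in> carrier G" for g
    using r[OF that] assms that subgroup.mem_carrier by (fastforce simp: l_coset_def)
  have m: "inv g \<otimes> r g \<in> H" if "g \<in> carrier G" for g
    using r[OF that] assms that subgroup.mem_carrier by (fastforce simp: l_coset_def group_word)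
  show eq: "r g = r h \<longleftrightarrow> inv g \<otimes> h \<in> H" if "g \<in> carrier G" "h \<in> carrier G" for g h
  proof
    assume rgh: "r g = r h"
    have "(inv g \<otimes> r g) \<otimes> inv (inv h \<otimes> r h) \<in> H"
      using m that assms by (simp add: subgroup.m_closed subgroup.m_inv_closed)
    then show "inv g \<otimes> h \<in> H"
      using that c[OF that(1)] c[OF that(2)] rgh by (simp add: group_word)
  next
    assume "inv g \<otimes> h \<in> H"
    then have "g <# H = h <# H"
      using that by (intro l_repr_independence[OF _ _ assms]) (auto simp: l_coset_def mult_inv_cancel_left intro!: bexI[of _ "inv g \<otimes> h"])
    then show "r g = r h"
      by (simp add: r_def)
  qed
  show "r (r g) = r g" if "g \<in> carrier G" for g
    using eq[OF that c[OF that]] m[OF that] by simp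
qed

lemma card_coset_representatives:
  assumes "subgroup H G" "\<And>g. g \<in> carrier G \<Longrightarrow> r g \<in> carrier G"
    and "\<And>g h. g \<in> carrier G \<Longrightarrow> h \<in> carrier G \<Longrightarrow> r g = r h \<longleftrightarrow> inv g \<otimes> h \<in> H"
    and "\<And>g. g \<in> carrier G \<Longrightarrow> r (r g) = r g"
  shows "card (r ` carrier G) * card H = order G"
proof -
  have H: "h \<in> carrier G" if "h \<in> H" for h
    using that by (rule subgroup.mem_carrier[OF assms(1)])
  have rH: "r (x \<otimes> h) = r x" if "x \<in> carrier G" "h \<in> H" for x h
    using that H[of h] assms(3)[of x "x \<otimes> h"] by (simp add: inv_mult_cancel_left)
  have "bij_betw (\<lambda>(x, h). x \<otimes> h) (r ` carrier G \<times> H) (carrier G)"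
  proof (rule bij_betw_byWitness[where f' = "\<lambda>g. (r g, inv (r g) \<otimes> g)"])
    show "\<forall>a\<in>r ` carrier G \<times> H. (\<lambda>g. (r g, inv (r g) \<otimes> g)) ((\<lambda>(x, h). x \<otimes> h) a) = a"
      using assms(2,4) rH H by (auto simp: inv_mult_cancel_left)
    show "\<forall>a\<in>carrier G. (\<lambda>(x, h). x \<otimes> h) (r a, inv (r a) \<otimes> a) = a"
      using assms(2) by (simp add: mult_inv_cancel_left)
    show "(\<lambda>(x, h). x \<otimes> h) ` (r ` carrier G \<times> H) \<subseteq> carrier G"
      using assms(2) H by auto
    have "inv (r g) \<otimes> g \<in> H" if "g \<in> carrier G" for g
      using assms(3)[of "r g" g] assms(2,4) that by simp
    then show "(\<lambda>g. (r g, inv (r g) \<otimes> g)) ` carrier G \<subseteq> r ` carrier G \<times> H"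
      by auto
  qed
  then show ?thesis
    by (simp add: order_def bij_betw_same_card flip: card_cartesian_product)
qed

end

section \<open>Fixed points of 2-groups and Sylow 2-subgroups\<close>

context group
begin

text \<open>Orbits have 2-power length, so all orbits other than the fixed points have even
  length.\<close>

lemma two_group_fixed_points_parity:
  assumes "order G = 2 ^ k" "finite E"
    and closed: "\<And>g x. g \<in> carrier G \<Longrightarrow> x \<in> E \<Longrightarrow> \<phi> g x \<in> E"
    and one: "\<And>x. x \<in> E \<Longrightarrow> \<phi> \<one> x = x"
    and mult: "\<And>g h x. g \<in> carrier G \<Longrightarrow> h \<in> carrier G \<Longrightarrow> x \<in> E \<Longrightarrow> \<phi> (g \<otimes> h) x = \<phi> g (\<phi> h x)"
  shows "even (card E) \<longleftrightarrow> even (card {x \<in> E. \<forall>g\<in>carrier G. \<phi> g x = x})"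
proof -
  \<comment> \<open>Members of \<open>Bij E\<close> are extensional, so \<open>\<phi>\<close> is
    restricted to \<open>E\<close>.\<close>
  let ?\<psi> = "\<lambda>g. \<lambda>x\<in>E. \<phi> g x"
  have "?\<psi> g \<in> Bij E" if g: "g \<in> carrier G" for g
  proof -
    have "bij_betw (\<phi> g) E E"
      using g closed one mult[of "inv g" g] mult[of g "inv g"]
      by (intro bij_betw_byWitness[where f' = "\<phi> (inv g)"]) auto
    then show ?thesis
      by (simp add: Bij_def)
  qed
  then have "group_action G E ?\<psi>"
    unfolding group_action_def
    by (intro group_hom.intro group_hom_axioms.intro homI group_BijGroup is_group)
      (auto simp: BijGroup_def closed mult compose_def fun_eq_iff restrict_def)
  then interpret group_action G E ?\<psi> .
  interpret partition E "orbits G E ?\<psi>"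
    by (rule orbit_partition)
  \<comment> \<open>With the indicator of fixed points added to 1, each orbit contributes an even
    amount: 2 for a singleton, its length otherwise.\<close>
  let ?f = "\<lambda>x. if \<forall>g\<in>carrier G. \<phi> g x = x then 1 else (0::nat)"
  have "even (\<Sum>x\<in>C. 1 + ?f x)" if C_orbit: "C \<in> orbits G E ?\<psi>" for C
  proof -
    obtain x where x: "x \<in> E" and C: "C = orbit G ?\<psi> x"
      using C_orbit unfolding orbits_def by blast
    have C': "C = {\<phi> g x |g. g \<in> carrier G}"
      using x by (auto simp: C orbit_def)
    have "card C dvd 2 ^ k"
      using orbit_stabilizer_theorem[OF x] C assms(1) by (metis dvd_triv_left)
    then obtain i where i: "card C = 2 ^ i"
      using divides_primepow_nat[OF two_is_prime_nat] by blast
    have xO: "x \<in> C"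
      unfolding C by (rule orbit_refl[OF x])
    show ?thesis
    proof (cases "i = 0")
      case True
      then have "C = {x}"
        using i xO by (auto simp: card_1_singleton_iff)
      then show ?thesis
        using C' by auto
    next
      case False
      have "\<not> (\<forall>g\<in>carrier G. \<phi> g y = y)" if y: "y \<in> C" for y
      proof
        assume fixed: "\<forall>g\<in>carrier G. \<phi> g y = y"
        obtain h where h: "h \<in> carrier G" "y = \<phi> h x"
          using y C' by auto
        have "\<phi> g x = y" if g: "g \<in> carrier G" for g
        proof -
          have "\<phi> (g \<otimes> inv h) y = \<phi> g x"
            using g h x closed by (simp add: m_assoc flip: mult)
          then show ?thesis
            using fixed g h by simp
        qed
        then have "C \<subseteq> {y}"
          using C' by auto
        then have "C = {y}"
          using y by auto
        then show False
          using i False by (cases i) auto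
      qed
      then have "(\<Sum>x\<in>C. 1 + ?f x) = (\<Sum>x\<in>C. 1)"
        by (intro sum.cong) auto
      then show ?thesis
        using i False by simp
    qed
  qed
  then have "even (\<Sum>x\<in>E. 1 + ?f x)"
    unfolding disjoint_sum[OF assms(2), symmetric] by (rule dvd_sum)
  moreover have "(\<Sum>x\<in>E. 1 + ?f x) = card E + card {x \<in> E. \<forall>g\<in>carrier G. \<phi> g x = x}"
    unfolding sum.distrib card_as_sums[OF refl assms(2)] by simp
  ultimately show ?thesis
    by simp
qed

lemma two_subgroup_fixed_points_parity:
  assumes "subgroup P G" "card P = 2 ^ k" "finite E"
    and "\<And>g x. g \<in> P \<Longrightarrow> x \<in> E \<Longrightarrow> \<phi> g x \<in> E"
    and "\<And>x. x \<in> E \<Longrightarrow> \<phi> \<one> x = x"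
    and "\<And>g h x. g \<in> P \<Longrightarrow> h \<in> P \<Longrightarrow> x \<in> E \<Longrightarrow> \<phi> (g \<otimes> h) x = \<phi> g (\<phi> h x)"
  shows "even (card E) \<longleftrightarrow> even (card {x \<in> E. \<forall>g\<in>P. \<phi> g x = x})"
  using group.two_group_fixed_points_parity[OF subgroup_imp_group[OF assms(1)], of k E \<phi>] assms
  by (simp add: order_def)

text \<open>\<open>Q\<close> acts by left multiplication on the \<open>m\<close> left cosets of
  \<open>S\<close>. As \<open>m\<close> is odd, some coset of a representative \<open>x\<close> is
  fixed, and then conjugation by \<open>inv x\<close> moves \<open>Q\<close> into
  \<open>S\<close>.\<close>

lemma two_subgroup_conj_subset_sylow:
  assumes "finite (carrier G)" "subgroup S G" "order G = card S * m" "odd m"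
    and "subgroup Q G" "card Q = 2 ^ k"
  shows "\<exists>g\<in>carrier G. \<forall>q\<in>Q. inv g \<otimes> q \<otimes> g \<in> S"
proof -
  obtain r where r: "\<And>g. g \<in> carrier G \<Longrightarrow> r g \<in> carrier G"
    "\<And>g h. g \<in> carrier G \<Longrightarrow> h \<in> carrier G \<Longrightarrow> r g = r h \<longleftrightarrow> inv g \<otimes> h \<in> S"
    "\<And>g. g \<in> carrier G \<Longrightarrow> r (r g) = r g"
    using coset_representatives[OF assms(2)] by blast
  let ?X = "r ` carrier G"
  have Q: "q \<in> carrier G" if "q \<in> Q" for q
    using that by (rule subgroup.mem_carrier[OF assms(5)])
  \<comment> \<open>Left multiplication respects left cosets, so multiplying and then taking
    representatives is an action.\<close>
  have rr: "r (g \<otimes> r h) = r (g \<otimes> h)" if "g \<in> carrier G" "h \<in> carrier G" for g h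
    using that r(1) r(3)[of h] r(2)[of "r h" h] r(2)[of "g \<otimes> r h" "g \<otimes> h"] by (simp add: group_word)
  have rrr: "r (g \<otimes> (h \<otimes> r x)) = r (g \<otimes> (h \<otimes> x))"
    if "g \<in> carrier G" "h \<in> carrier G" "x \<in> carrier G" for g h x
    using that r(1) rr[of "g \<otimes> h" x] by (simp add: m_assoc)
  have "card S > 0"
    using assms(1) subgroup.subset[OF assms(2)] subgroup.one_closed[OF assms(2)]
    by (auto simp: card_gt_0_iff intro: finite_subset)
  then have "card ?X = m"
    using card_coset_representatives[OF assms(2) r] assms(3) by simp
  moreover have "even (card ?X) \<longleftrightarrow> even (card {x \<in> ?X. \<forall>g\<in>Q. r (g \<otimes> x) = x})"
  proof (rule two_subgroup_fixed_points_parity[OF assms(5,6)])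
    show "finite ?X"
      using assms(1) by simp
  qed (use r(1) r(3) rr rrr Q in \<open>auto simp: m_assoc\<close>)
  ultimately have "odd (card {x \<in> ?X. \<forall>g\<in>Q. r (g \<otimes> x) = x})"
    using assms(4) by simp
  then have "{x \<in> ?X. \<forall>g\<in>Q. r (g \<otimes> x) = x} \<noteq> {}"
    by (rule contrapos_nn) (simp only: card.empty even_zero)
  then obtain x where x: "x \<in> ?X" "\<forall>g\<in>Q. r (g \<otimes> x) = x"
    by blast
  have xc: "x \<in> carrier G" "r x = x"
    using x(1) r by auto
  have "inv x \<otimes> q \<otimes> x \<in> S" if "q \<in> Q" for q
    using x(2) that xc r(2)[of x "q \<otimes> x"] Q by (simp add: m_assoc)
  then show ?thesis
    using xc by blast
qed

lemma subgroup_card_dvd: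
  assumes "subgroup K G" "subgroup H G" "K \<subseteq> H"
  shows "card K dvd card H"
proof -
  interpret H: group "G\<lparr>carrier := H\<rparr>"
    using assms(2) by (rule subgroup_imp_group)
  have eq: "card H = card (rcosets\<^bsub>G\<lparr>carrier := H\<rparr>\<^esub> K) * card K"
    using H.lagrange[OF subgroup_incl[OF assms]] by (simp add: order_def)
  show ?thesis
    unfolding eq by simp
qed

lemma subgroup_of_two_subgroup:
  assumes "subgroup K G" "subgroup H G" "K \<subseteq> H" "card H = 2 ^ k"
  obtains i where "card K = 2 ^ i" "i \<le> k"
  using subgroup_card_dvd[OF assms(1-3)] assms(4) divides_primepow_nat[OF two_is_prime_nat] by auto

text \<open>\<open>D\<close> acts on its own left cosets, whose number is even because
  \<open>D\<close> is proper. The coset \<open>D\<close> is fixed, so there is a second fixed coset,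
  with representative \<open>x\<close>, and \<open>inv x\<close> normalizes \<open>D\<close> from
  outside.\<close>

lemma two_group_normalizer_grows:
  assumes "order G = 2 ^ k" "subgroup D G" "D \<noteq> carrier G"
  shows "\<exists>g\<in>carrier G. g \<notin> D \<and> (\<forall>d\<in>D. g \<otimes> d \<otimes> inv g \<in> D)"
proof -
  obtain r where r: "\<And>g. g \<in> carrier G \<Longrightarrow> r g \<in> carrier G"
    "\<And>g h. g \<in> carrier G \<Longrightarrow> h \<in> carrier G \<Longrightarrow> r g = r h \<longleftrightarrow> inv g \<otimes> h \<in> D"
    "\<And>g. g \<in> carrier G \<Longrightarrow> r (r g) = r g"
    using coset_representatives[OF assms(2)] by blast
  let ?X = "r ` carrier G"
  have fin: "finite (carrier G)"
    using assms(1) by (simp add: order_gt_0_iff_finite[symmetric])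
  have D: "d \<in> carrier G" if "d \<in> D" for d
    using that by (rule subgroup.mem_carrier[OF assms(2)])
  have rr: "r (g \<otimes> r h) = r (g \<otimes> h)" if "g \<in> carrier G" "h \<in> carrier G" for g h
    using that r(1) r(3)[of h] r(2)[of "r h" h] r(2)[of "g \<otimes> r h" "g \<otimes> h"] by (simp add: group_word)
  have rrr: "r (g \<otimes> (h \<otimes> r x)) = r (g \<otimes> (h \<otimes> x))"
    if "g \<in> carrier G" "h \<in> carrier G" "x \<in> carrier G" for g h x
    using that r(1) rr[of "g \<otimes> h" x] by (simp add: m_assoc)
  obtain i where i: "card D = 2 ^ i" "i \<le> k"
    using subgroup_of_two_subgroup[OF assms(2) subgroup_self] subgroup.subset[OF assms(2)] assms(1)
    by (auto simp: order_def)
  have card_X: "card ?X * card D = order G"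
    by (rule card_coset_representatives[OF assms(2) r])
  have "i \<noteq> k"
    using card_subset_eq[OF fin subgroup.subset[OF assms(2)]] assms(1,3) i by (auto simp: order_def)
  then have "card ?X * 2 ^ i = 2 ^ (k - i) * 2 ^ i" "k - i > 0"
    using i card_X assms(1) by (simp_all flip: power_add)
  then have "even (card ?X)"
    by simp
  moreover have "even (card ?X) \<longleftrightarrow> even (card {x \<in> ?X. \<forall>g\<in>D. r (g \<otimes> x) = x})"
  proof (rule two_subgroup_fixed_points_parity[OF assms(2) i(1)])
    show "finite ?X"
      using fin by simp
  qed (use r(1) r(3) rr rrr D in \<open>auto simp: m_assoc\<close>)
  ultimately have "even (card {x \<in> ?X. \<forall>g\<in>D. r (g \<otimes> x) = x})"
    by simp
  then have "{x \<in> ?X. \<forall>g\<in>D. r (g \<otimes> x) = x} \<noteq> {r \<one>}"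
    by (metis is_singletonI is_singleton_altdef odd_one)
  moreover have "r \<one> \<in> {x \<in> ?X. \<forall>g\<in>D. r (g \<otimes> x) = x}"
  proof -
    have "r (d \<otimes> r \<one>) = r \<one>" if "d \<in> D" for d
      using that D[OF that] rr[of d \<one>] r(2)[of \<one> d] by simp
    then show ?thesis
      by auto
  qed
  ultimately obtain x where x: "x \<in> ?X" "\<forall>d\<in>D. r (d \<otimes> x) = x" "x \<noteq> r \<one>"
    by blast
  have xc: "x \<in> carrier G" "r x = x"
    using x(1) r by auto
  have "inv x \<otimes> d \<otimes> x \<in> D" if "d \<in> D" for d
    using x(2) that xc r(2)[of x "d \<otimes> x"] D by (simp add: m_assoc)
  moreover have "inv x \<notin> D"
  proof
    assume "inv x \<in> D"
    then have "r \<one> = r x"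
      using xc r(2)[of \<one> x] subgroup.m_inv_closed[OF assms(2), of "inv x"] by simp
    then show False
      using x(3) xc by simp
  qed
  ultimately show ?thesis
    using xc by (intro bexI[of _ "inv x"]) auto
qed

lemma two_subgroup_normalizer_grows:
  assumes "subgroup P G" "card P = 2 ^ k" "subgroup D G" "D \<subset> P"
  obtains g where "g \<in> P" "g \<notin> D" "\<And>d. d \<in> D \<Longrightarrow> g \<otimes> d \<otimes> inv g \<in> D"
  using group.two_group_normalizer_grows[OF subgroup_imp_group[OF assms(1)], of k D] assms
    subgroup_incl[OF assms(3,1)] by (auto simp: order_def)

text \<open>If \<open>a\<close> lies outside \<open>K\<close>, its left coset fills
  \<open>T - K\<close> by counting. Membership in \<open>K\<close> thus behaves like a parity on
  \<open>T\<close>.\<close>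

lemma half_subgroup_mult_iff:
  assumes "finite (carrier G)" "subgroup K G" "subgroup T G" "K \<subseteq> T" "card T = 2 * card K" "a \<in> T" "b \<in> T"
  shows "a \<otimes> b \<in> K \<longleftrightarrow> (a \<in> K \<longleftrightarrow> b \<in> K)"
proof -
  interpret K: subgroup K G by fact
  interpret T: subgroup T G by fact
  have fin: "finite T"
    using assms(1) T.subset by (rule finite_subset[rotated])
  have c: "a \<in> carrier G" "b \<in> carrier G"
    using assms(6,7) by auto
  show ?thesis
  proof (cases "a \<in> K")
    case True
    have "b \<in> K" if "a \<otimes> b \<in> K"
      using K.m_closed[OF K.m_inv_closed[OF True] that] c by (simp add: inv_mult_cancel_left)
    then show ?thesis
      using True K.m_closed[OF True] by blast
  next
    case False
    have sub: "(\<otimes>) a ` K \<subseteq> T - K"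
    proof
      fix y assume "y \<in> (\<otimes>) a ` K"
      then obtain x where x: "x \<in> K" "y = a \<otimes> x"
        by blast
      have "a \<in> K" if "a \<otimes> x \<in> K"
        using K.m_closed[OF that K.m_inv_closed[OF x(1)]] x(1) c by (simp add: m_assoc)
      then have "y \<notin> K"
        using x(2) False by blast
      then show "y \<in> T - K"
        using x assms(4,6) T.m_closed by auto
    qed
    have "card ((\<otimes>) a ` K) = card K"
      using c by (intro card_image) (auto simp: inj_on_def)
    moreover have "card (T - K) = card K"
      using assms(4,5) fin by (simp add: card_Diff_subset finite_subset)
    ultimately have "(\<otimes>) a ` K = T - K"
      using card_subset_eq[OF _ sub] fin by simp
    moreover have "a \<otimes> b \<in> (\<otimes>) a ` K \<longleftrightarrow> b \<in> K"
      using c by (auto simp: image_iff)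
    ultimately have "a \<otimes> b \<in> T - K \<longleftrightarrow> b \<in> K"
      by simp
    then show ?thesis
      using False T.m_closed[OF assms(6,7)] by auto
  qed
qed

end

section \<open>Fusion under local 2-nilpotency\<close>

definition conj_image :: "('a, 'b) monoid_scheme \<Rightarrow> 'a \<Rightarrow> 'a set \<Rightarrow> 'a set" where
  "conj_image G g S = (\<lambda>x. g \<otimes>\<^bsub>G\<^esub> x \<otimes>\<^bsub>G\<^esub> inv\<^bsub>G\<^esub> g) ` S"

definition normalizing :: "('a, 'b) monoid_scheme \<Rightarrow> 'a set \<Rightarrow> 'a set" where
  "normalizing G S = {g \<in> carrier G. conj_image G g S = S}"

context group
begin

lemma conj_image_mult:
  assumes "g \<in> carrier G" "h \<in> carrier G" "S \<subseteq> carrier G"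
  shows "conj_image G (g \<otimes> h) S = conj_image G g (conj_image G h S)"
proof -
  have "g \<otimes> h \<otimes> x \<otimes> inv (g \<otimes> h) = g \<otimes> (h \<otimes> x \<otimes> inv h) \<otimes> inv g" if "x \<in> S" for x
    using assms that by (auto simp: group_word)
  then show ?thesis
    by (simp add: conj_image_def image_image)
qed

lemma conj_image_one:
  assumes "S \<subseteq> carrier G"
  shows "conj_image G \<one> S = S"
proof -
  have "\<one> \<otimes> x \<otimes> inv \<one> = x" if "x \<in> S" for x
    using assms that by auto
  then show ?thesis
    by (simp add: conj_image_def)
qed

lemma conj_image_closed:
  assumes "g \<in> carrier G" "S \<subseteq> carrier G"
  shows "conj_image G g S \<subseteq> carrier G"
  using assms by (auto simp: conj_image_def)

lemma mem_conj_image_iff: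
  assumes "g \<in> carrier G" "S \<subseteq> carrier G" "x \<in> carrier G"
  shows "x \<in> conj_image G g S \<longleftrightarrow> inv g \<otimes> x \<otimes> g \<in> S"
proof
  assume "x \<in> conj_image G g S"
  then obtain y where y: "y \<in> S" "x = g \<otimes> y \<otimes> inv g"
    by (auto simp: conj_image_def)
  moreover have "y \<in> carrier G"
    using y assms(2) by blast
  ultimately show "inv g \<otimes> x \<otimes> g \<in> S"
    using assms(1) by (simp add: group_word)
next
  assume "inv g \<otimes> x \<otimes> g \<in> S"
  moreover have "x = g \<otimes> (inv g \<otimes> x \<otimes> g) \<otimes> inv g"
    using assms by (simp add: group_word)
  ultimately show "x \<in> conj_image G g S"
    unfolding conj_image_def by (rule rev_image_eqI)
qed

lemma card_conj_image:
  assumes "g \<in> carrier G" "S \<subseteq> carrier G"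
  shows "card (conj_image G g S) = card S"
  unfolding conj_image_def using assms by (intro card_image inj_onI) (auto simp: subsetD)

lemma subgroup_conj_image:
  assumes "g \<in> carrier G" "subgroup S G"
  shows "subgroup (conj_image G g S) G"
proof -
  interpret S: subgroup S G by fact
  show ?thesis
  proof (rule subgroupI)
    show "conj_image G g S \<subseteq> carrier G"
      by (rule conj_image_closed[OF assms(1) S.subset])
    show "conj_image G g S \<noteq> {}"
      using S.one_closed unfolding conj_image_def by blast
    show "inv a \<in> conj_image G g S" if a: "a \<in> conj_image G g S" for a
    proof -
      obtain x where x: "x \<in> S" "a = g \<otimes> x \<otimes> inv g"
        using a by (auto simp: conj_image_def)
      then have "inv a = g \<otimes> inv x \<otimes> inv g"
        using assms(1) by (simp add: group_word)
      then show ?thesis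
        using x by (auto simp: conj_image_def)
    qed
    show "a \<otimes> b \<in> conj_image G g S" if a: "a \<in> conj_image G g S" and b: "b \<in> conj_image G g S" for a b
    proof -
      obtain x y where xy: "x \<in> S" "a = g \<otimes> x \<otimes> inv g" "y \<in> S" "b = g \<otimes> y \<otimes> inv g"
        using a b by (auto simp: conj_image_def)
      then have "a \<otimes> b = g \<otimes> (x \<otimes> y) \<otimes> inv g"
        using assms(1) by (simp add: group_word)
      then show ?thesis
        using xy by (auto simp: conj_image_def)
    qed
  qed
qed

lemma subgroup_normalizing:
  assumes "S \<subseteq> carrier G"
  shows "subgroup (normalizing G S) G"
proof (rule subgroupI)
  show "normalizing G S \<noteq> {}"
    using conj_image_one[OF assms] by (auto simp: normalizing_def)
  show "inv a \<in> normalizing G S" if "a \<in> normalizing G S" for a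
    using that conj_image_mult[of "inv a" a S] conj_image_one[OF assms] assms
    by (simp add: normalizing_def)
  show "a \<otimes> b \<in> normalizing G S" if "a \<in> normalizing G S" "b \<in> normalizing G S" for a b
    using that conj_image_mult[of a b S] assms by (simp add: normalizing_def)
qed (auto simp: normalizing_def)

text \<open>By finiteness, an injective image contained in \<open>S\<close> is all of
  \<open>S\<close>.\<close>

lemma normalizingI:
  assumes "finite (carrier G)" "S \<subseteq> carrier G" "g \<in> carrier G" "\<And>x. x \<in> S \<Longrightarrow> g \<otimes> x \<otimes> inv g \<in> S"
  shows "g \<in> normalizing G S"
proof -
  have "conj_image G g S \<subseteq> S"
    using assms(4) by (auto simp: conj_image_def)
  moreover have "finite S"
    using assms(1,2) by (rule finite_subset[rotated])
  ultimately show ?thesis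
    using card_subset_eq[of S "conj_image G g S"] card_conj_image[OF assms(3,2)] assms(3)
    by (simp add: normalizing_def)
qed

lemma normalizingD:
  assumes "g \<in> normalizing G S"
  shows "g \<in> carrier G" "x \<in> S \<Longrightarrow> g \<otimes> x \<otimes> inv g \<in> S"
  using assms by (auto simp: normalizing_def conj_image_def)

lemma subgroup_subset_normalizing:
  assumes "finite (carrier G)" "subgroup S G"
  shows "S \<subseteq> normalizing G S"
proof
  interpret S: subgroup S G by fact
  show "x \<in> normalizing G S" if "x \<in> S" for x
    using that by (intro normalizingI[OF assms(1) S.subset]) auto
qed

lemma two_subgroup_conj_subset_sylow_of:
  assumes "finite (carrier G)" "subgroup N G" "subgroup S G" "S \<subseteq> N" "card N = card S * m" "odd m"
    and "subgroup Q G" "Q \<subseteq> N" "card Q = 2 ^ k"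
  shows "\<exists>g\<in>N. \<forall>q\<in>Q. inv g \<otimes> q \<otimes> g \<in> S"
proof -
  have "finite N"
    using assms(1) subgroup.subset[OF assms(2)] by (rule finite_subset[rotated])
  then show ?thesis
    using group.two_subgroup_conj_subset_sylow[OF subgroup_imp_group[OF assms(2)], of S m Q k]
      subgroup_incl[OF assms(3,2,4)] subgroup_incl[OF assms(7,2,8)] assms by (simp add: order_def)
qed

text \<open>Sylow's theorem gives some \<open>S\<close> of the right order; \<open>Q\<close> can be
  conjugated into it, and the inverse conjugation moves \<open>S\<close> over
  \<open>Q\<close>.\<close>

lemma two_subgroup_subset_sylow_of:
  assumes "finite (carrier G)" "subgroup N G" "card N = 2 ^ b * m" "odd m"
    and "subgroup Q G" "Q \<subseteq> N" "card Q = 2 ^ k"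
  obtains S where "subgroup S G" "S \<subseteq> N" "card S = 2 ^ b" "Q \<subseteq> S"
proof -
  interpret N: subgroup N G by fact
  interpret Q: subgroup Q G by fact
  have "finite N"
    using assms(1) N.subset by (rule finite_subset[rotated])
  then obtain S where "subgroup S (G\<lparr>carrier := N\<rparr>)" and card: "card S = 2 ^ b"
    using sylow_thm[OF two_is_prime_nat subgroup_imp_group[OF assms(2)], of b m] assms(3)
    by (auto simp: order_def)
  then have S: "subgroup S G" "S \<subseteq> N"
    using incl_subgroup[OF assms(2)] subgroup.subset[of S "G\<lparr>carrier := N\<rparr>"] by auto
  obtain g where g: "g \<in> N" "\<forall>q\<in>Q. inv g \<otimes> q \<otimes> g \<in> S"
    using two_subgroup_conj_subset_sylow_of[OF assms(1,2) S _ assms(4-7)] assms(3) card by auto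
  show thesis
  proof
    show "subgroup (conj_image G g S) G"
      using g S by (intro subgroup_conj_image) auto
    show "conj_image G g S \<subseteq> N"
      using g S by (auto simp: conj_image_def)
    show "card (conj_image G g S) = 2 ^ b"
      using g card card_conj_image[of g S] subgroup.subset[OF S(1)] by auto
    show "Q \<subseteq> conj_image G g S"
      using g mem_conj_image_iff[of g S] subgroup.subset[OF S(1)] by auto
  qed
qed

text \<open>Multiplication is injective on \<open>K \<times> R\<close> since the intersection is
  trivial, and the orders make it onto \<open>N\<close>.\<close>

lemma mem_product_of_disjoint_subgroups:
  assumes "finite (carrier G)" "subgroup N G" "subgroup K G" "subgroup R G" "K \<subseteq> N" "R \<subseteq> N"
    and "K \<inter> R \<subseteq> {\<one>}" "card N = card K * card R" "g \<in> N"
  obtains u v where "u \<in> K" "v \<in> R" "g = u \<otimes> v"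
proof -
  interpret N: subgroup N G by fact
  interpret K: subgroup K G by fact
  interpret R: subgroup R G by fact
  let ?f = "\<lambda>(u, v). u \<otimes> v"
  have "inj_on ?f (K \<times> R)"
  proof (rule inj_onI, clarify)
    fix u v u' v' assume uv: "u \<in> K" "v \<in> R" "u' \<in> K" "v' \<in> R" and eq: "u \<otimes> v = u' \<otimes> v'"
    have "inv u' \<otimes> u = v' \<otimes> inv v"
    proof -
      have "inv u' \<otimes> (u \<otimes> v) \<otimes> inv v = inv u' \<otimes> (u' \<otimes> v') \<otimes> inv v"
        by (simp add: eq)
      then show ?thesis
        using uv by (simp add: group_word)
    qed
    moreover have "inv u' \<otimes> u \<in> K" "v' \<otimes> inv v \<in> R"
      using uv by simp_all
    ultimately have "inv u' \<otimes> u = \<one>" "v' \<otimes> inv v = \<one>"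
      using assms(7) by auto
    then show "u = u' \<and> v = v'"
      using uv by (simp add: inv_solve_left' inv_solve_right')
  qed
  then have "card (?f ` (K \<times> R)) = card N"
    using assms(8) by (simp add: card_image card_cartesian_product)
  moreover have "?f ` (K \<times> R) \<subseteq> N"
    using assms(5,6) by auto
  moreover have "finite N"
    using assms(1) N.subset by (rule finite_subset[rotated])
  ultimately have "?f ` (K \<times> R) = N"
    by (intro card_subset_eq)
  then show thesis
    using that assms(9) by auto
qed

text \<open>Inside \<open>H\<close> both \<open>K\<close> and \<open>D\<close> are invariant under
  conjugation, and they meet trivially because one order is odd and the other a power of 2.\<close>

lemma complement_commutes_with_normal_two_subgroup:
  assumes "finite (carrier G)" "subgroup D G" "card D = 2 ^ k" "normal_two_complement G H K"
    and "D \<subseteq> H" "H \<subseteq> normalizing G D" "u \<in> K" "d \<in> D"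
  shows "u \<otimes> d = d \<otimes> u"
proof -
  have K: "subgroup K G" "K \<subseteq> H" "\<forall>h\<in>H. \<forall>n\<in>K. h \<otimes> n \<otimes> inv h \<in> K" "odd (card K)"
    using assms(4) by (auto simp: normal_two_complement_def)
  show ?thesis
    using K(2,3) assms(5-8) odd_and_two_subgroups_disjoint[OF K(1,4) assms(2,3)] normalizingD(2)
    by (intro normal_subgroups_commute[OF K(1) assms(2)]) auto
qed

text \<open>The induction is on the index of \<open>D\<close>. The normal 2-complement of \<open>N(D)\<close> centralizes \<open>D\<close> and
  moves \<open>N(D) \<inter> T\<close> into a Sylow 2-subgroup of \<open>N(D)\<close> containing \<open>N(D) \<inter> S\<close>; both intersections are
  larger than \<open>D\<close>.\<close>

lemma centralizer_transitive_on_sylow: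
  assumes fin: "finite (carrier G)" and ord: "order G = 2 ^ a * m" "odd m"
    and local: "\<And>D k. subgroup D G \<Longrightarrow> card D = 2 ^ k \<Longrightarrow> \<not> D \<subseteq> Z
      \<Longrightarrow> \<exists>K. normal_two_complement G (normalizing G D) K"
  shows "\<lbrakk>subgroup D G; card D = 2 ^ k; \<not> D \<subseteq> Z; subgroup S G; card S = 2 ^ a; D \<subseteq> S;
    subgroup T G; card T = 2 ^ a; D \<subseteq> T\<rbrakk>
    \<Longrightarrow> \<exists>c\<in>carrier G. (\<forall>d\<in>D. c \<otimes> d = d \<otimes> c) \<and> T = conj_image G c S"
proof (induct "order G - card D" arbitrary: D k S T rule: less_induct)
  case less
  note D = \<open>subgroup D G\<close> and S = \<open>subgroup S G\<close> and T = \<open>subgroup T G\<close>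
  note Dc = subgroup.subset[OF D] and Sc = subgroup.subset[OF S] and Tc = subgroup.subset[OF T]
  have finS: "finite S" and finT: "finite T"
    using fin Sc Tc finite_subset by auto
  show ?case
  proof (cases "D = S \<or> D = T")
    case True
    \<comment> \<open>\<open>D\<close> is contained in both groups, which have equal order.\<close>
    then have "S = T"
      using less.prems finS finT card_subset_eq by metis
    then show ?thesis
      using conj_image_one[OF Sc] Dc by (intro bexI[of _ \<one>]) auto
  next
    case False
    let ?N = "normalizing G D"
    have N: "subgroup ?N G"
      by (rule subgroup_normalizing[OF Dc])
    have DN: "D \<subseteq> ?N"
      by (rule subgroup_subset_normalizing[OF fin D])
    obtain K where K: "normal_two_complement G ?N K"
      using local[OF D less.prems(2,3)] by blast
    then have K': "subgroup K G" "K \<subseteq> ?N" "odd (card K)"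
      by (auto simp: normal_two_complement_def)
    obtain b where b: "card ?N = card K * 2 ^ b"
      using K by (auto simp: normal_two_complement_def)
    have KD: "u \<otimes> d = d \<otimes> u" if "u \<in> K" "d \<in> D" for u d
      by (rule complement_commutes_with_normal_two_subgroup[OF fin D less.prems(2) K DN order_refl that])
    \<comment> \<open>Normalizers grow in the 2-group \<open>P\<close>; this provides the larger
      subgroups to which the induction hypothesis will be applied.\<close>
    have grow: "subgroup (?N \<inter> P) G \<and> (\<exists>i. card (?N \<inter> P) = 2 ^ i) \<and> card D < card (?N \<inter> P)"
      if P: "subgroup P G" "card P = 2 ^ a" "D \<subseteq> P" "D \<noteq> P" for P
    proof -
      have sub: "subgroup (?N \<inter> P) G"
        by (rule subgroups_Inter_pair[OF N P(1)])
      obtain g where g: "g \<in> P" "g \<notin> D" "\<And>d. d \<in> D \<Longrightarrow> g \<otimes> d \<otimes> inv g \<in> D"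
        using two_subgroup_normalizer_grows[OF P(1,2) D] P(3,4) by blast
      have "g \<in> ?N"
        using g subgroup.mem_carrier[OF P(1)] by (intro normalizingI[OF fin Dc]) auto
      then have "D \<subset> ?N \<inter> P"
        using g DN P(3) by blast
      moreover have "finite (?N \<inter> P)"
        using fin subgroup.subset[OF sub] by (rule finite_subset[rotated])
      ultimately have "card D < card (?N \<inter> P)"
        by (rule psubset_card_mono[rotated])
      moreover obtain i where "card (?N \<inter> P) = 2 ^ i"
        by (rule subgroup_of_two_subgroup[OF sub P(1) Int_lower2 P(2)])
      ultimately show ?thesis
        using sub by simp
    qed
    obtain i where NS: "subgroup (?N \<inter> S) G" "card (?N \<inter> S) = 2 ^ i" "card D < card (?N \<inter> S)"
      using grow[OF S less.prems(5,6)] False by blast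
    obtain j where NT: "subgroup (?N \<inter> T) G" "card (?N \<inter> T) = 2 ^ j" "card D < card (?N \<inter> T)"
      using grow[OF T less.prems(8,9)] False by blast
    obtain R where R: "subgroup R G" "R \<subseteq> ?N" "card R = 2 ^ b" "?N \<inter> S \<subseteq> R"
      using two_subgroup_subset_sylow_of[OF fin N _ K'(3) NS(1) _ NS(2), of b] b by auto
    obtain g where g: "g \<in> ?N" "\<forall>q\<in>?N \<inter> T. inv g \<otimes> q \<otimes> g \<in> R"
      using two_subgroup_conj_subset_sylow_of[OF fin N R(1,2) _ K'(3) NT(1) _ NT(2)] b R(3) by auto
    obtain u v where uv: "u \<in> K" "v \<in> R" "g = u \<otimes> v"
      using mem_product_of_disjoint_subgroups[OF fin N K'(1) R(1) K'(2) R(2)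
          odd_and_two_subgroups_disjoint[OF K'(1,3) R(1,3)] _ g(1)] b R(3) by auto
    have uc: "u \<in> carrier G" and vc: "v \<in> carrier G"
      using subgroup.mem_carrier[OF K'(1) uv(1)] subgroup.mem_carrier[OF R(1) uv(2)] by auto
    have uR: "inv u \<otimes> q \<otimes> u \<in> R" if q: "q \<in> ?N \<inter> T" for q
    proof -
      have "q \<in> carrier G"
        using q Tc by auto
      then have "inv u \<otimes> q \<otimes> u = v \<otimes> (inv g \<otimes> q \<otimes> g) \<otimes> inv v"
        using uc vc by (simp add: uv(3) group_word)
      then show ?thesis
        using g(2) q uv(2) R(1) by (simp add: subgroup.m_closed subgroup.m_inv_closed)
    qed
    have "card (carrier G) = 2 ^ a * m"
      using ord(1) by (simp add: order_def)
    \<comment> \<open>The Sylow subgroup \<open>P\<close> links the two given ones: it shares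
      \<open>?N \<inter> S\<close> with \<open>S\<close>, and the conjugate \<open>?E\<close> of
      \<open>?N \<inter> T\<close> with a conjugate of \<open>T\<close>. Both shared subgroups
      contain \<open>D\<close> properly.\<close>
    then obtain P where P: "subgroup P G" "P \<subseteq> carrier G" "card P = 2 ^ a" "R \<subseteq> P"
      by (rule two_subgroup_subset_sylow_of[OF fin subgroup_self _ ord(2) R(1) subgroup.subset[OF R(1)] R(3)])
    have le: "card H \<le> order G" if "subgroup H G" for H
      using card_mono[OF fin subgroup.subset[OF that]] by (simp add: order_def)
    obtain c where c: "c \<in> carrier G" "\<forall>d\<in>?N \<inter> S. c \<otimes> d = d \<otimes> c" "P = conj_image G c S"
    proof -
      have lt: "order G - card (?N \<inter> S) < order G - card D"
        using NS(3) le[OF NS(1)] by linarith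
      have nZ: "\<not> ?N \<inter> S \<subseteq> Z"
        using less.prems(3,6) DN by blast
      have NP: "?N \<inter> S \<subseteq> P"
        using R(4) P(4) by blast
      show thesis
        using less.hyps[OF lt NS(1,2) nZ S less.prems(5) Int_lower2 P(1,3) NP] that by blast
    qed
    let ?E = "conj_image G (inv u) (?N \<inter> T)"
    have DE: "D \<subseteq> ?E"
    proof
      fix d assume d: "d \<in> D"
      then have "u \<otimes> d \<otimes> inv u = d"
        using KD[OF uv(1) d] conj_eq_iff_commute[OF uc] Dc by blast
      then show "d \<in> ?E"
        using d DN less.prems(9) mem_conj_image_iff[of "inv u" "?N \<inter> T" d] uc Dc Tc by auto
    qed
    have NTc: "?N \<inter> T \<subseteq> carrier G"
      using Tc by blast
    obtain e where e: "e \<in> carrier G" "\<forall>d\<in>?E. e \<otimes> d = d \<otimes> e" "conj_image G (inv u) T = conj_image G e P"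
    proof -
      have cardE: "card ?E = card (?N \<inter> T)"
        using uc NTc by (simp add: card_conj_image)
      have E: "subgroup ?E G"
        using uc NT(1) by (simp add: subgroup_conj_image)
      have lt: "order G - card ?E < order G - card D"
        using NT(3) cardE le[OF E] by linarith
      have nZ: "\<not> ?E \<subseteq> Z"
        using less.prems(3) DE by blast
      have EP: "?E \<subseteq> P"
        using uR uc P(4) by (auto simp: conj_image_def)
      have ET: "?E \<subseteq> conj_image G (inv u) T"
        by (auto simp: conj_image_def)
      have uT: "subgroup (conj_image G (inv u) T) G" "card (conj_image G (inv u) T) = 2 ^ a"
        using uc T Tc less.prems(8) by (simp_all add: subgroup_conj_image card_conj_image)
      show thesis
        using less.hyps[OF lt E cardE[unfolded NT(2)] nZ P(1,3) EP uT ET] that by blast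
    qed
    \<comment> \<open>The links from \<open>S\<close> to \<open>P\<close>, from \<open>P\<close> to
      the conjugate of \<open>T\<close>, and from there to \<open>T\<close> compose;
      \<open>c\<close>, \<open>e\<close> and \<open>u\<close> all centralize
      \<open>D\<close>.\<close>
    have "T = conj_image G u (conj_image G (inv u) T)"
      using conj_image_mult[of u "inv u" T] uc Tc conj_image_one[OF Tc] by simp
    also have "\<dots> = conj_image G (u \<otimes> (e \<otimes> c)) S"
      using uc c(1) e(1) Sc by (simp add: e(3) c(3) conj_image_mult conj_image_closed)
    finally have "T = conj_image G (u \<otimes> (e \<otimes> c)) S" .
    moreover have "u \<otimes> (e \<otimes> c) \<otimes> d = d \<otimes> (u \<otimes> (e \<otimes> c))" if d: "d \<in> D" for d
    proof -
      have dc: "d \<in> carrier G"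
        using d Dc by blast
      have "c \<otimes> d = d \<otimes> c" "e \<otimes> d = d \<otimes> e" "u \<otimes> d = d \<otimes> u"
        using c(2) e(2) KD[OF uv(1) d] d DN DE less.prems(6) by auto
      then show ?thesis
        using dc uc c(1) e(1) by (metis m_assoc m_closed)
    qed
    ultimately show ?thesis
      using uc c(1) e(1) by (intro bexI[of _ "u \<otimes> (e \<otimes> c)"]) auto
  qed
qed

text \<open>A noncentral \<open>v\<close> lies in the intersection of \<open>T\<close> with its
  conjugate by \<open>inv x\<close>. Some \<open>c\<close> centralizing this intersection carries
  the conjugate back to \<open>T\<close>, so \<open>c \<otimes> inv x\<close> normalizes
  \<open>T\<close> and equals \<open>u \<otimes> t\<close>, where \<open>u\<close> centralizes
  \<open>T\<close> and \<open>t\<close> lies in \<open>T\<close>. On \<open>v\<close> the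
  conjugation by \<open>x\<close> then agrees with that by \<open>inv t\<close>.\<close>

lemma sylow_controls_fusion:
  assumes fin: "finite (carrier G)" and ord: "order G = 2 ^ a * m" "odd m"
    and local: "\<And>D k. subgroup D G \<Longrightarrow> card D = 2 ^ k \<Longrightarrow> \<not> D \<subseteq> Z
      \<Longrightarrow> \<exists>K. normal_two_complement G (normalizing G D) K"
    and central: "\<And>z g. z \<in> Z \<Longrightarrow> g \<in> carrier G \<Longrightarrow> g \<otimes> z = z \<otimes> g"
    and T: "subgroup T G" "card T = 2 ^ a"
    and x: "x \<in> carrier G" and v: "v \<in> T" "x \<otimes> v \<otimes> inv x \<in> T"
  shows "\<exists>t\<in>T. x \<otimes> v \<otimes> inv x = t \<otimes> v \<otimes> inv t"
proof (cases "v \<in> Z")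
  case True
  have "v \<in> carrier G"
    using subgroup.mem_carrier[OF T(1) v(1)] .
  then have "x \<otimes> v \<otimes> inv x = \<one> \<otimes> v \<otimes> inv \<one>"
    using central[OF True x] x by (simp add: m_assoc)
  then show ?thesis
    using subgroup.one_closed[OF T(1)] by blast
next
  case False
  note Tc = subgroup.subset[OF T(1)]
  have vc: "v \<in> carrier G"
    using v(1) Tc by blast
  let ?T' = "conj_image G (inv x) T"
  have T': "subgroup ?T' G" "card ?T' = 2 ^ a"
    using x T Tc by (auto simp: subgroup_conj_image card_conj_image)
  have D: "subgroup (T \<inter> ?T') G"
    by (rule subgroups_Inter_pair[OF T(1) T'(1)])
  obtain i where i: "card (T \<inter> ?T') = 2 ^ i"
    by (rule subgroup_of_two_subgroup[OF D T(1) Int_lower1 T(2)])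
  have vD: "v \<in> T \<inter> ?T'"
    using v x vc Tc by (simp add: mem_conj_image_iff)
  have nZ: "\<not> T \<inter> ?T' \<subseteq> Z"
    using vD False by blast
  have "\<exists>c\<in>carrier G. (\<forall>d\<in>T \<inter> ?T'. c \<otimes> d = d \<otimes> c) \<and> T = conj_image G c ?T'"
    by (rule centralizer_transitive_on_sylow[OF fin ord _ D i nZ T' Int_lower2 T Int_lower1]) (rule local)
  then obtain c where c: "c \<in> carrier G" "\<forall>d\<in>T \<inter> ?T'. c \<otimes> d = d \<otimes> c" "T = conj_image G c ?T'"
    by blast
  let ?n = "c \<otimes> inv x"
  have "?n \<in> normalizing G T"
    using c(1) x Tc c(3) by (simp add: normalizing_def conj_image_mult)
  obtain K where K: "normal_two_complement G (normalizing G T) K"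
    using local[OF T] False v(1) by blast
  then have K': "subgroup K G" "K \<subseteq> normalizing G T" "odd (card K)"
    by (auto simp: normal_two_complement_def)
  obtain b where b: "card (normalizing G T) = card K * 2 ^ b"
    using K by (auto simp: normal_two_complement_def)
  have TN: "T \<subseteq> normalizing G T"
    by (rule subgroup_subset_normalizing[OF fin T(1)])
  have N: "subgroup (normalizing G T) G"
    by (rule subgroup_normalizing[OF Tc])
  \<comment> \<open>\<open>T\<close> is a Sylow 2-subgroup of its normalizer, so the 2-part
    \<open>2 ^ b\<close> of the order of the normalizer is \<open>2 ^ a\<close>.\<close>
  have "card (normalizing G T) = card K * card T"
  proof -
    have "2 ^ a dvd card K * 2 ^ b"
      using subgroup_card_dvd[OF T(1) N TN] b T(2) by simp
    then have "(2::nat) ^ a dvd 2 ^ b"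
      using K'(3) by (simp add: coprime_dvd_mult_right_iff)
    moreover have "card K * 2 ^ b dvd 2 ^ a * m"
      using subgroup_card_dvd[OF N subgroup_self] subgroup.subset[OF N] b ord(1) by (simp add: order_def)
    then have "2 ^ b dvd 2 ^ a * m"
      by (rule dvd_mult_right)
    then have "(2::nat) ^ b dvd 2 ^ a"
      using ord(2) by (simp add: coprime_dvd_mult_left_iff)
    ultimately show ?thesis
      using b T(2) by (simp add: dvd_antisym)
  qed
  then obtain u t where ut: "u \<in> K" "t \<in> T" "?n = u \<otimes> t"
    using mem_product_of_disjoint_subgroups[OF fin N K'(1) T(1) K'(2) TN
        odd_and_two_subgroups_disjoint[OF K'(1,3) T] _ \<open>?n \<in> normalizing G T\<close>] by blast
  have uc: "u \<in> carrier G" and tc: "t \<in> carrier G"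
    using subgroup.mem_carrier[OF K'(1) ut(1)] subgroup.mem_carrier[OF T(1) ut(2)] by auto
  have uv: "u \<otimes> v = v \<otimes> u"
    by (rule complement_commutes_with_normal_two_subgroup[OF fin T K TN order_refl ut(1) v(1)])
  have xe: "x = inv t \<otimes> inv u \<otimes> c"
  proof -
    have "inv ?n \<otimes> c = x"
      using c(1) x by (simp add: group_word)
    then show ?thesis
      using uc tc by (simp add: ut(3) inv_mult_group)
  qed
  have "x \<otimes> v \<otimes> inv x = inv t \<otimes> (inv u \<otimes> (c \<otimes> v \<otimes> inv c) \<otimes> u) \<otimes> t"
    using vc uc tc c(1) by (simp add: xe group_word)
  also have "c \<otimes> v \<otimes> inv c = v"
    using c(1,2) vD vc by (simp add: m_assoc)
  also have "inv u \<otimes> v \<otimes> u = v"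
    using uv uc vc commute_inv[OF uc vc uv] by (simp add: m_assoc)
  finally have "x \<otimes> v \<otimes> inv x = inv t \<otimes> v \<otimes> inv (inv t)"
    using tc by simp
  then show ?thesis
    using subgroup.m_inv_closed[OF T(1) ut(2)] by blast
qed

end

section \<open>Transfer onto a quotient of order two\<close>

context group
begin

text \<open>\<open>V\<close> is the transfer to \<open>T / K\<close>, written with values \<open>\<plusminus>1\<close>. To evaluate it at \<open>u \<in> T\<close>, base points
  \<open>b x\<close> of the \<open>T\<close>-orbits on cosets are chosen; stability makes the sign \<open>\<mu>\<close> well defined, and each
  factor of \<open>V u\<close> becomes \<open>s u\<close> times a coboundary of \<open>\<mu>\<close>, which cancels in the product.\<close>

lemma transfer_normal_subgroup_index_two:
  assumes fin: "finite (carrier G)" and T: "subgroup T G" and ord: "order G = card T * m" "odd m"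
    and K: "subgroup K G" "K \<subseteq> T" "card T = 2 * card K"
    and mult_iff: "\<And>a b. a \<in> T \<Longrightarrow> b \<in> T \<Longrightarrow> a \<otimes> b \<in> K \<longleftrightarrow> (a \<in> K \<longleftrightarrow> b \<in> K)"
    and stable: "\<And>x v. x \<in> carrier G \<Longrightarrow> v \<in> T \<Longrightarrow> inv x \<otimes> v \<otimes> x \<in> T \<Longrightarrow> inv x \<otimes> v \<otimes> x \<in> K \<longleftrightarrow> v \<in> K"
  shows "\<exists>N. N \<lhd> G \<and> order G = 2 * card N"
proof -
  interpret T: subgroup T G by fact
  obtain r where r: "\<And>g. g \<in> carrier G \<Longrightarrow> r g \<in> carrier G"
    "\<And>g h. g \<in> carrier G \<Longrightarrow> h \<in> carrier G \<Longrightarrow> r g = r h \<longleftrightarrow> inv g \<otimes> h \<in> T"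
    "\<And>g. g \<in> carrier G \<Longrightarrow> r (r g) = r g"
    using coset_representatives[OF T] by blast
  define E where "E = r ` carrier G"
  have E: "x \<in> carrier G" "r x = x" if "x \<in> E" for x
    using that r by (auto simp: E_def)
  have rE: "r g \<in> E" if "g \<in> carrier G" for g
    using that by (auto simp: E_def)
  have finE: "finite E"
    using fin by (simp add: E_def)
  have posT: "card T > 0"
    by (rule T.finite_imp_card_positive[OF fin])
  have cardE: "card E = m"
    using card_coset_representatives[OF T r] ord(1) posT by (simp add: E_def)
  have rr: "r (g \<otimes> r h) = r (g \<otimes> h)" if "g \<in> carrier G" "h \<in> carrier G" for g h
    using that r(1) r(3)[of h] r(2)[of "r h" h] r(2)[of "g \<otimes> r h" "g \<otimes> h"] by (simp add: group_word)
  have rT: "inv x \<otimes> g \<in> T" if "x = r g" "g \<in> carrier G" for x g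
    using that r(1)[of g] r(3)[of g] r(2)[of x g] by simp

  \<comment> \<open>The sign character of \<open>T\<close> and the transfer\<close>
  define s where "s t = (if t \<in> K then 1 else - 1 :: int)" for t
  have s_mult: "s (a \<otimes> b) = s a * s b" if "a \<in> T" "b \<in> T" for a b
    using mult_iff[OF that] by (simp add: s_def)
  have s_sq [simp]: "s a * s a = 1" "s a * (s a * z) = z" for a z
    by (simp_all add: s_def)
  define V where "V g = (\<Prod>x\<in>E. s (inv (r (g \<otimes> x)) \<otimes> (g \<otimes> x)))" for g
  have bij: "bij_betw (\<lambda>x. r (h \<otimes> x)) E E" if h: "h \<in> carrier G" for h
  proof (rule bij_betw_byWitness[where f' = "\<lambda>x. r (inv h \<otimes> x)"])
    show "\<forall>a\<in>E. r (inv h \<otimes> r (h \<otimes> a)) = a" "\<forall>a\<in>E. r (h \<otimes> r (inv h \<otimes> a)) = a"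
      using h E by (simp_all add: rr inv_mult_cancel_left mult_inv_cancel_left)
  qed (use h E rE in auto)
  \<comment> \<open>With \<open>y = r (h \<otimes> x)\<close>, the \<open>T\<close>-part of
    \<open>g \<otimes> h \<otimes> x\<close> is that of \<open>g \<otimes> y\<close> times that of
    \<open>h \<otimes> x\<close>. Since \<open>x \<mapsto> y\<close> permutes \<open>E\<close>, the
    first factors multiply to \<open>V g\<close>.\<close>
  have V_mult: "V (g \<otimes> h) = V g * V h" if g: "g \<in> carrier G" and h: "h \<in> carrier G" for g h
  proof -
    have "s (inv (r (g \<otimes> h \<otimes> x)) \<otimes> (g \<otimes> h \<otimes> x)) =
        s (inv (r (g \<otimes> r (h \<otimes> x))) \<otimes> (g \<otimes> r (h \<otimes> x))) * s (inv (r (h \<otimes> x)) \<otimes> (h \<otimes> x))"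
      if "x \<in> E" for x
    proof -
      have x: "x \<in> carrier G"
        by (rule E(1)[OF that])
      define y where "y = r (h \<otimes> x)"
      have y: "y \<in> carrier G" "r (g \<otimes> y) = r (g \<otimes> h \<otimes> x)"
        using g h x r(1) by (simp_all add: y_def rr m_assoc)
      have "inv (r (g \<otimes> h \<otimes> x)) \<otimes> (g \<otimes> h \<otimes> x) = (inv (r (g \<otimes> y)) \<otimes> (g \<otimes> y)) \<otimes> (inv y \<otimes> (h \<otimes> x))"
        using g h x y r(1) by (simp add: group_word)
      then show ?thesis
        using g h x y(1) by (simp add: s_mult rT y_def[symmetric])
    qed
    then have "V (g \<otimes> h) = (\<Prod>x\<in>E. s (inv (r (g \<otimes> r (h \<otimes> x))) \<otimes> (g \<otimes> r (h \<otimes> x)))) * V h"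
      by (simp add: V_def prod.distrib)
    also have "(\<Prod>x\<in>E. s (inv (r (g \<otimes> r (h \<otimes> x))) \<otimes> (g \<otimes> r (h \<otimes> x)))) = V g"
      unfolding V_def by (rule prod.reindex_bij_betw[OF bij[OF h]])
    finally show ?thesis .
  qed
  have V_cases: "V g = 1 \<or> V g = - 1" for g
  proof -
    have "\<bar>V g\<bar> = (\<Prod>x\<in>E. 1)"
      unfolding V_def abs_prod by (intro prod.cong) (auto simp: s_def)
    then show ?thesis
      by auto
  qed
  have V_one: "V \<one> = 1"
    using V_mult[of \<one> \<one>] V_cases[of \<one>] by auto
  obtain u where u: "u \<in> T" "u \<notin> K"
  proof -
    have "T \<noteq> K"
      using K(3) posT by auto
    then show thesis
      using K(2) that by blast
  qed
  have uc: "u \<in> carrier G"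
    using u by simp
  define orb where "orb x = (\<lambda>t. r (t \<otimes> x)) ` T" for x
  \<comment> \<open>The choice depends on \<open>x\<close> only through the set
    \<open>orb x\<close>, so \<open>b\<close> is constant on each orbit.\<close>
  define b where "b x = (SOME y. y \<in> orb x)" for x
  have b_orb: "b x \<in> orb x" for x
    unfolding b_def by (rule someI_ex) (use T.one_closed in \<open>unfold orb_def, blast\<close>)
  have orb_u: "orb (r (u \<otimes> x)) = orb x" if "x \<in> E" for x
  proof -
    have x: "x \<in> carrier G"
      by (rule E(1)[OF that])
    show ?thesis
    proof
      show "orb (r (u \<otimes> x)) \<subseteq> orb x"
      proof
        fix y assume "y \<in> orb (r (u \<otimes> x))"
        then obtain t where "t \<in> T" "y = r (t \<otimes> r (u \<otimes> x))"
          by (auto simp: orb_def)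
        then have "t \<otimes> u \<in> T" "y = r (t \<otimes> u \<otimes> x)"
          using x uc u(1) by (simp_all add: rr m_assoc)
        then show "y \<in> orb x"
          unfolding orb_def by blast
      qed
      show "orb x \<subseteq> orb (r (u \<otimes> x))"
      proof
        fix y assume "y \<in> orb x"
        then obtain t where "t \<in> T" "y = r (t \<otimes> x)"
          by (auto simp: orb_def)
        then have "t \<otimes> inv u \<in> T" "y = r (t \<otimes> inv u \<otimes> r (u \<otimes> x))"
          using x uc u(1) by (simp_all add: rr group_word)
        then show "y \<in> orb (r (u \<otimes> x))"
          unfolding orb_def by blast
      qed
    qed
  qed
  define \<tau> where "\<tau> x = (SOME t. t \<in> T \<and> x = r (t \<otimes> b x))" for x
  have bc: "b x \<in> carrier G" if "x \<in> E" for x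
  proof -
    obtain t where "t \<in> T" "b x = r (t \<otimes> x)"
      using b_orb[of x] by (auto simp: orb_def)
    then show ?thesis
      using E(1)[OF that] r(1) by simp
  qed
  have \<tau>: "\<tau> x \<in> T" "r (\<tau> x \<otimes> b x) = x" if "x \<in> E" for x
  proof -
    have x: "x \<in> carrier G" "r x = x"
      using E[OF that] by auto
    obtain t where t: "t \<in> T" "b x = r (t \<otimes> x)"
      using b_orb[of x] by (auto simp: orb_def)
    then have "inv t \<in> T \<and> x = r (inv t \<otimes> b x)"
      using x by (simp add: rr inv_mult_cancel_left)
    then have "\<tau> x \<in> T \<and> x = r (\<tau> x \<otimes> b x)"
      unfolding \<tau>_def by (rule someI)
    then show "\<tau> x \<in> T" "r (\<tau> x \<otimes> b x) = x"
      by auto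
  qed
  define \<mu> where "\<mu> x = s (inv x \<otimes> (\<tau> x \<otimes> b x)) * s (\<tau> x)" for x
  \<comment> \<open>Two elements of \<open>T\<close> that carry \<open>y = b x\<close> to the coset
    of \<open>x\<close> differ by some \<open>?w\<close> whose conjugate by \<open>inv y\<close> is
    again in \<open>T\<close>. By \<open>stable\<close> this conjugate has the same sign as
    \<open>?w\<close>, so the two changes of sign cancel.\<close>
  have \<mu>_eq: "\<mu> x = s (inv x \<otimes> (t \<otimes> b x)) * s t" if x: "x \<in> E" and t: "t \<in> T" "r (t \<otimes> b x) = x" for x t
  proof -
    define y where "y = b x"
    have yc: "y \<in> carrier G"
      using bc[OF x] by (simp add: y_def)
    have xc: "x \<in> carrier G"
      by (rule E(1)[OF x])
    have ry: "r (t \<otimes> y) = x" "r (\<tau> x \<otimes> y) = x"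
      using t(2) \<tau>(2)[OF x] by (simp_all add: y_def)
    let ?w = "inv t \<otimes> \<tau> x"
    have w: "?w \<in> T"
      using t(1) \<tau>(1)[OF x] by simp
    have ywy: "inv y \<otimes> ?w \<otimes> y \<in> T"
      using r(2)[of "t \<otimes> y" "\<tau> x \<otimes> y"] ry t(1) \<tau>(1)[OF x] yc by (simp add: group_word)
    have xt: "inv x \<otimes> (t \<otimes> y) \<in> T"
      using rT[of x "t \<otimes> y"] ry(1) t(1) yc by simp
    have "inv x \<otimes> (\<tau> x \<otimes> y) = (inv x \<otimes> (t \<otimes> y)) \<otimes> (inv y \<otimes> ?w \<otimes> y)"
      using xc yc t(1) \<tau>(1)[OF x] by (simp add: group_word)
    then have "s (inv x \<otimes> (\<tau> x \<otimes> y)) = s (inv x \<otimes> (t \<otimes> y)) * s (inv y \<otimes> ?w \<otimes> y)"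
      using xt ywy by (simp only: s_mult)
    moreover have "s (inv y \<otimes> ?w \<otimes> y) = s ?w"
      using stable[OF yc w ywy] by (simp add: s_def)
    moreover have "s (\<tau> x) = s t * s ?w"
    proof -
      have "\<tau> x = t \<otimes> ?w"
        using t(1) \<tau>(1)[OF x] by (simp add: mult_inv_cancel_left)
      then show ?thesis
        using s_mult[OF t(1) w] by simp
    qed
    ultimately show ?thesis
      by (simp add: \<mu>_def flip: y_def)
  qed
  have \<mu>_sq: "\<mu> x * \<mu> x = 1" for x
    by (simp add: \<mu>_def s_def)
  have factor: "s (inv (r (u \<otimes> x)) \<otimes> (u \<otimes> x)) = s u * (\<mu> (r (u \<otimes> x)) * \<mu> x)" if x: "x \<in> E" for x
  proof -
    define y where "y = b x"
    define x' where "x' = r (u \<otimes> x)"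
    have yc: "y \<in> carrier G"
      using bc[OF x] by (simp add: y_def)
    have xc: "x \<in> carrier G" "x' \<in> carrier G"
      using E(1)[OF x] uc r(1) by (auto simp: x'_def)
    have \<tau>x: "\<tau> x \<in> T" "r (\<tau> x \<otimes> y) = x"
      using \<tau>[OF x] by (simp_all add: y_def)
    have y': "b x' = y"
      using orb_u[OF x] by (simp add: b_def x'_def y_def)
    have x'E: "x' \<in> E"
      unfolding x'_def using uc xc(1) by (intro rE) simp
    \<comment> \<open>As \<open>x\<close> and \<open>x'\<close> share the base point
      \<open>y\<close>, the element \<open>u \<otimes> \<tau> x\<close> may replace
      \<open>\<tau> x'\<close> when computing \<open>\<mu> x'\<close>.\<close>
    have "r (u \<otimes> \<tau> x \<otimes> y) = x'"
      using xc(1) uc yc \<tau>x rr[of u "\<tau> x \<otimes> y"] by (simp add: x'_def m_assoc)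
    then have rx': "r (u \<otimes> \<tau> x \<otimes> b x') = x'"
      by (simp only: y')
    have "\<mu> x' = s (inv x' \<otimes> (u \<otimes> \<tau> x \<otimes> y)) * s (u \<otimes> \<tau> x)"
      using \<mu>_eq[OF x'E _ rx'] u(1) \<tau>x(1) by (simp add: y')
    also have "inv x' \<otimes> (u \<otimes> \<tau> x \<otimes> y) = (inv x' \<otimes> (u \<otimes> x)) \<otimes> (inv x \<otimes> (\<tau> x \<otimes> y))"
      using xc uc yc \<tau>x(1) by (simp add: group_word)
    also have "s \<dots> = s (inv x' \<otimes> (u \<otimes> x)) * s (inv x \<otimes> (\<tau> x \<otimes> y))"
      using rT[of x' "u \<otimes> x"] rT[of x "\<tau> x \<otimes> y"] uc xc yc \<tau>x by (intro s_mult) (simp_all add: x'_def)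
    also have "s (u \<otimes> \<tau> x) = s u * s (\<tau> x)"
      by (rule s_mult[OF u(1) \<tau>x(1)])
    finally have "\<mu> x' = s (inv x' \<otimes> (u \<otimes> x)) * s u * \<mu> x"
      by (simp add: \<mu>_def y_def)
    then have "s u * (\<mu> x' * \<mu> x) = s (inv x' \<otimes> (u \<otimes> x)) * (s u * s u) * (\<mu> x * \<mu> x)"
      by (simp only: mult_ac)
    then show ?thesis
      by (simp add: x'_def[symmetric] \<mu>_sq)
  qed
  have "V u = s u ^ m * ((\<Prod>x\<in>E. \<mu> (r (u \<otimes> x))) * (\<Prod>x\<in>E. \<mu> x))"
    by (simp add: V_def factor prod.distrib cardE)
  also have "(\<Prod>x\<in>E. \<mu> (r (u \<otimes> x))) = (\<Prod>x\<in>E. \<mu> x)"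
    by (rule prod.reindex_bij_betw[OF bij[OF uc]])
  also have "(\<Prod>x\<in>E. \<mu> x) * (\<Prod>x\<in>E. \<mu> x) = 1"
    by (simp add: \<mu>_sq flip: prod.distrib)
  finally have V_u: "V u = - 1"
    using u(2) ord(2) by (simp add: s_def)

  \<comment> \<open>The kernel of the transfer\<close>
  define N where "N = {g \<in> carrier G. V g = 1}"
  have V_inv: "V (inv g) = V g" if "g \<in> carrier G" for g
    using V_mult[of g "inv g"] V_one V_cases[of g] that by auto
  have "subgroup N G"
    by (rule subgroupI) (use V_one V_inv V_mult in \<open>auto simp: N_def\<close>)
  moreover have "x \<otimes> h \<otimes> inv x \<in> N" if "x \<in> carrier G" "h \<in> N" for x h
    using that V_cases[of x] by (auto simp: N_def V_mult V_inv)
  ultimately have normal: "N \<lhd> G"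
    by (auto simp: normal_inv_iff)
  \<comment> \<open>As \<open>V u = - 1\<close>, multiplication by \<open>u\<close> exchanges the
    kernel and its complement, so the index is 2.\<close>
  have "bij_betw ((\<otimes>) u) N (carrier G - N)"
  proof (rule bij_betw_byWitness[where f' = "(\<otimes>) (inv u)"])
    have "inv u \<otimes> g \<in> N" if "g \<in> carrier G - N" for g
      using that uc V_cases[of g] by (auto simp: N_def V_mult V_inv V_u)
    then show "(\<otimes>) (inv u) ` (carrier G - N) \<subseteq> N"
      by blast
  qed (use uc in \<open>auto simp: N_def V_mult V_u inv_mult_cancel_left mult_inv_cancel_left\<close>)
  then have "card (carrier G - N) = card N"
    using bij_betw_same_card by metis
  moreover have "N \<subseteq> carrier G"
    by (auto simp: N_def)
  ultimately have "order G = 2 * card N"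
    using fin card_mono[of "carrier G" N] by (simp add: order_def card_Diff_subset finite_subset)
  then show ?thesis
    using normal by blast
qed

end

section \<open>Elementwise form of the hypotheses\<close>

text \<open>The relations make \<open>s = i \<otimes> i\<close> commute with \<open>i\<close> and
  \<open>j\<close>, give \<open>s \<otimes> s = \<one>\<close> and allow reordering of
  \<open>j \<otimes> i\<close>. Products thus have eight normal forms, which are distinct once
  \<open>s\<close> is nontrivial.\<close>

lemma (in group) Q8_embedding:
  assumes i: "i \<in> carrier G" and j: "j \<in> carrier G"
    and sq: "i \<otimes> i = j \<otimes> j" and iji: "i \<otimes> j \<otimes> i = j" and nontriv: "i \<otimes> i \<noteq> \<one>"
  shows "\<exists>\<psi>\<in>hom Q8 G. inj_on \<psi> (carrier Q8)"
proof -
  define s where "s = i \<otimes> i"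
  have s: "s \<in> carrier G"
    using i by (simp add: s_def)
  have ii: "i \<otimes> i = s" and jj: "j \<otimes> j = s"
    using sq by (simp_all add: s_def)
  have iis: "i \<otimes> s = s \<otimes> i"
    using i by (simp add: s_def m_assoc)
  have jss: "j \<otimes> s = s \<otimes> j"
    using j by (simp add: jj[symmetric] m_assoc)
  have iji': "i \<otimes> (j \<otimes> i) = j"
    using iji i j by (simp add: m_assoc)
  have "s \<otimes> (j \<otimes> i) = i \<otimes> j"
  proof -
    have "s \<otimes> (j \<otimes> i) = i \<otimes> (i \<otimes> (j \<otimes> i))"
      using i j by (simp add: s_def m_assoc)
    then show ?thesis
      by (simp add: iji')
  qed
  moreover have ji: "j \<otimes> i = s \<otimes> (i \<otimes> j)"
  proof -
    have "j \<otimes> i = (i \<otimes> j \<otimes> i) \<otimes> i"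
      by (simp add: iji)
    also have "\<dots> = i \<otimes> (j \<otimes> s)"
      using i j by (simp add: s_def m_assoc)
    also have "\<dots> = s \<otimes> (i \<otimes> j)"
      using i j s by (simp add: jss iis flip: m_assoc)
    finally show ?thesis .
  qed
  \<comment> \<open>Exchanging \<open>i\<close> and \<open>j\<close> costs a factor \<open>s\<close>
    in either direction, so doing it twice costs nothing.\<close>
  ultimately have "(s \<otimes> s) \<otimes> (i \<otimes> j) = \<one> \<otimes> (i \<otimes> j)"
    using i j s by (simp add: m_assoc)
  then have ss: "s \<otimes> s = \<one>"
    using i j s by (simp del: l_one)
  have assoc: "s \<otimes> (s \<otimes> z) = z" "i \<otimes> (i \<otimes> z) = s \<otimes> z" "j \<otimes> (j \<otimes> z) = s \<otimes> z"
    "i \<otimes> (s \<otimes> z) = s \<otimes> (i \<otimes> z)" "j \<otimes> (s \<otimes> z) = s \<otimes> (j \<otimes> z)" "j \<otimes> (i \<otimes> z) = s \<otimes> (i \<otimes> (j \<otimes> z))"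
    if "z \<in> carrier G" for z
    using that i j s ss ii jj iis jss ji by (simp_all flip: m_assoc)
  note rules = ss ii jj iis jss ji assoc
  have s1: "s \<noteq> \<one>"
    using nontriv by (simp add: ii)
  have i1: "i \<noteq> \<one>" and j1: "j \<noteq> \<one>"
    using s1 ii jj by auto
  have isn: "i \<noteq> s" and jsn: "j \<noteq> s"
    using s1 ii jj ss by auto
  have ijn: "i \<otimes> j \<noteq> \<one>"
  proof
    assume "i \<otimes> j = \<one>"
    then have "j = i"
      using iji i by simp
    then show False
      using \<open>i \<otimes> j = \<one>\<close> ii s1 by simp
  qed
  have ijs: "i \<otimes> j \<noteq> s"
  proof
    assume ij: "i \<otimes> j = s"
    then have "j = i"
      using i j ii by (metis l_cancel)
    then have "s \<otimes> i = i"
      using iji ij by simp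
    then show False
      using i s s1 by simp
  qed
  have neq: "s \<otimes> z \<noteq> \<one>" if "z \<in> carrier G" "z \<noteq> s" for z
    using that s ss by (metis l_cancel)
  \<comment> \<open>The tests find the single nonzero coordinate. The quaternion \<open>-1\<close>
    goes to \<open>s\<close>, and \<open>k\<close> to \<open>i \<otimes> j\<close>.\<close>
  define \<psi> :: "int \<times> int \<times> int \<times> int \<Rightarrow> 'a" where
    "\<psi> = (\<lambda>(a, b, c, d). if a = 1 then \<one> else if a = - 1 then s else if b = 1 then i else if b = - 1 then s \<otimes> i
       else if c = 1 then j else if c = - 1 then s \<otimes> j else if d = 1 then i \<otimes> j else s \<otimes> (i \<otimes> j))"
  have "\<psi> \<in> hom Q8 G"
    using i j s by (intro homI) (auto simp: Q8_def \<psi>_def m_assoc rules)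
  moreover have "inj_on \<psi> (carrier Q8)"
    using s1 i1 j1 ijn i j neq isn jsn ijs
    by (subst inj_on_one_iff'[OF \<open>\<psi> \<in> hom Q8 G\<close> group_Q8 is_group]) (auto simp: Q8_def \<psi>_def)
  ultimately show ?thesis
    by blast
qed

text \<open>Modulo \<open>B\<close> the relations read \<open>i\<^sup>2 = j\<^sup>2\<close> and \<open>i j i = j\<close>, which present the quaternion group; its
  only quotient in which \<open>i\<^sup>2\<close> survives is the group itself.\<close>

definition no_Q8_section_relations :: "('a, 'b) monoid_scheme \<Rightarrow> bool" where
  "no_Q8_section_relations G \<longleftrightarrow>
     (\<forall>A B i j. subgroup A G \<longrightarrow> subgroup B G \<longrightarrow> B \<subseteq> A \<longrightarrow>
        (\<forall>a\<in>A. \<forall>b\<in>B. a \<otimes>\<^bsub>G\<^esub> b \<otimes>\<^bsub>G\<^esub> inv\<^bsub>G\<^esub> a \<in> B) \<longrightarrow> i \<in> A \<longrightarrow> j \<in> A \<longrightarrow>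
        i \<otimes>\<^bsub>G\<^esub> i \<otimes>\<^bsub>G\<^esub> inv\<^bsub>G\<^esub> (j \<otimes>\<^bsub>G\<^esub> j) \<in> B \<longrightarrow> i \<otimes>\<^bsub>G\<^esub> j \<otimes>\<^bsub>G\<^esub> i \<otimes>\<^bsub>G\<^esub> inv\<^bsub>G\<^esub> j \<in> B \<longrightarrow>
        i \<otimes>\<^bsub>G\<^esub> i \<in> B)"

text \<open>Equivalently, some quotient of \<open>G\<close> maps \<open>t\<close> to a nontrivial
  central element. Leaving \<open>N\<close> existential lets intersections and images serve as
  witnesses in subgroups and quotients.\<close>

definition involutions_split :: "('a, 'b) monoid_scheme \<Rightarrow> bool" where
  "involutions_split G \<longleftrightarrow>
     (\<forall>t\<in>carrier G. t \<noteq> \<one>\<^bsub>G\<^esub> \<longrightarrow> t \<otimes>\<^bsub>G\<^esub> t = \<one>\<^bsub>G\<^esub> \<longrightarrow>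
        (\<exists>N. N \<lhd> G \<and> t \<notin> N \<and> (\<forall>g\<in>carrier G. t \<otimes>\<^bsub>G\<^esub> g \<otimes>\<^bsub>G\<^esub> inv\<^bsub>G\<^esub> t \<otimes>\<^bsub>G\<^esub> inv\<^bsub>G\<^esub> g \<in> N)))"

lemma (in normal) rcos_eq_iff:
  assumes "x \<in> carrier G" "y \<in> carrier G"
  shows "H #> x = H #> y \<longleftrightarrow> x \<otimes> inv y \<in> H"
proof
  assume "H #> x = H #> y"
  then have "x \<in> H #> y"
    using rcos_self[OF assms(1) subgroup_axioms] by simp
  then show "x \<otimes> inv y \<in> H"
    using assms by (auto simp: r_coset_def m_assoc)
next
  assume "x \<otimes> inv y \<in> H"
  moreover have "x = x \<otimes> inv y \<otimes> y"
    using assms by (simp add: m_assoc)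
  ultimately have "x \<in> H #> y"
    unfolding r_coset_def by blast
  then show "H #> x = H #> y"
    using repr_independence[OF _ assms(2) subgroup_axioms] by simp
qed

text \<open>If \<open>i \<otimes> i\<close> were outside \<open>B\<close>, the cosets of
  \<open>i\<close> and \<open>j\<close> would yield a copy \<open>S\<close> of \<open>Q8\<close> in
  the quotient of \<open>A\<close> by \<open>B\<close>. The union of the cosets in \<open>S\<close>
  is a subgroup whose quotient by \<open>B\<close> is \<open>S\<close>, a forbidden section.\<close>

lemma (in group) Q8_free_imp_no_Q8_section_relations:
  assumes "Q8_free G"
  shows "no_Q8_section_relations G"
  unfolding no_Q8_section_relations_def
proof (intro allI impI, rule ccontr)
  fix A B i j
  assume A: "subgroup A G" and B: "subgroup B G" "B \<subseteq> A" "\<forall>a\<in>A. \<forall>b\<in>B. a \<otimes> b \<otimes> inv a \<in> B"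
    and ij: "i \<in> A" "j \<in> A" and rel: "i \<otimes> i \<otimes> inv (j \<otimes> j) \<in> B" "i \<otimes> j \<otimes> i \<otimes> inv j \<in> B" "i \<otimes> i \<notin> B"
  let ?A = "G\<lparr>carrier := A\<rparr>"
  interpret A: group ?A
    using A by (rule subgroup_imp_group)
  interpret B: normal B ?A
    using A B subgroup_incl[OF B(1) A B(2)] by (simp add: A.normal_inv_iff)
  interpret Q: group "?A Mod B"
    by (rule B.factorgroup_is_group)
  have coset: "B #>\<^bsub>?A\<^esub> x \<in> carrier (?A Mod B)" if "x \<in> A" for x
    using that by (auto simp: FactGroup_def RCOSETS_def)
  have mult: "(B #>\<^bsub>?A\<^esub> x) \<otimes>\<^bsub>?A Mod B\<^esub> (B #>\<^bsub>?A\<^esub> y) = B #>\<^bsub>?A\<^esub> (x \<otimes> y)" if "x \<in> A" "y \<in> A" for x y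
    using that B.rcos_sum[of x y] by (simp add: FactGroup_def)
  have eq: "B #>\<^bsub>?A\<^esub> x = B #>\<^bsub>?A\<^esub> y \<longleftrightarrow> x \<otimes> inv y \<in> B" if "x \<in> A" "y \<in> A" for x y
    using that B.rcos_eq_iff[of x y] A by simp
  have closed: "x \<otimes> y \<in> A" if "x \<in> A" "y \<in> A" for x y
    using that A by (rule subgroup.m_closed[rotated])
  have one: "\<one>\<^bsub>?A Mod B\<^esub> = B #>\<^bsub>?A\<^esub> \<one>"
    using A.coset_mult_one[OF B.subset] by (simp add: FactGroup_def)
  have "\<exists>\<psi>\<in>hom Q8 (?A Mod B). inj_on \<psi> (carrier Q8)"
  proof (rule Q.Q8_embedding[OF coset[OF ij(1)] coset[OF ij(2)]])
    have oneA: "\<one> \<in> A"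
      by (rule subgroup.one_closed[OF A])
    have "i \<in> carrier G"
      by (rule subgroup.mem_carrier[OF A ij(1)])
    then show "(B #>\<^bsub>?A\<^esub> i) \<otimes>\<^bsub>?A Mod B\<^esub> (B #>\<^bsub>?A\<^esub> i) \<noteq> \<one>\<^bsub>?A Mod B\<^esub>"
      unfolding mult[OF ij(1,1)] one eq[OF closed[OF ij(1,1)] oneA] using rel(3) by simp
    show "(B #>\<^bsub>?A\<^esub> i) \<otimes>\<^bsub>?A Mod B\<^esub> (B #>\<^bsub>?A\<^esub> i) = (B #>\<^bsub>?A\<^esub> j) \<otimes>\<^bsub>?A Mod B\<^esub> (B #>\<^bsub>?A\<^esub> j)"
      unfolding mult[OF ij(1,1)] mult[OF ij(2,2)] eq[OF closed[OF ij(1,1)] closed[OF ij(2,2)]] by (rule rel(1))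
    show "(B #>\<^bsub>?A\<^esub> i) \<otimes>\<^bsub>?A Mod B\<^esub> (B #>\<^bsub>?A\<^esub> j) \<otimes>\<^bsub>?A Mod B\<^esub> (B #>\<^bsub>?A\<^esub> i) = B #>\<^bsub>?A\<^esub> j"
      unfolding mult[OF ij] mult[OF closed[OF ij] ij(1)] eq[OF closed[OF closed[OF ij] ij(1)] ij(2)] by (rule rel(2))
  qed
  then obtain \<psi> where \<psi>: "\<psi> \<in> hom Q8 (?A Mod B)" "inj_on \<psi> (carrier Q8)"
    by blast
  define S where "S = \<psi> ` carrier Q8"
  interpret \<psi>: group_hom Q8 "?A Mod B" \<psi>
    using \<psi>(1) group_Q8 Q.is_group by (simp add: group_hom_def group_hom_axioms_def)
  have S: "subgroup S (?A Mod B)"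
    unfolding S_def by (rule \<psi>.img_is_subgroup)
  have U: "subgroup (\<Union>S) ?A"
    by (rule B.factgroup_subgroup_union_subgroup[OF S])
  have UA: "\<Union>S \<subseteq> A"
    using subgroup.subset[OF U] by simp
  have "B \<in> S"
    using subgroup.one_closed[OF S] by (simp add: FactGroup_def)
  then have BU: "B \<subseteq> \<Union>S"
    by blast
  have "B \<lhd> ?A\<lparr>carrier := \<Union>S\<rparr>"
    by (rule A.normal_restrict_supergroup[OF U B.normal_axioms BU])
  then have normal: "B \<lhd> G\<lparr>carrier := \<Union>S\<rparr>"
    by simp
  have "G\<lparr>carrier := A, carrier := \<Union>S\<rparr> = G\<lparr>carrier := \<Union>S\<rparr>"
    by simp
  then have carr: "carrier (G\<lparr>carrier := \<Union>S\<rparr> Mod B) = S"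
    using B.factgroup_subgroup_union_factor[OF S] unfolding FactGroup_def by (simp only: partial_object.select_convs)
  have "\<psi> \<in> hom Q8 (G\<lparr>carrier := \<Union>S\<rparr> Mod B)"
  proof (rule homI)
    show "\<psi> x \<in> carrier (G\<lparr>carrier := \<Union>S\<rparr> Mod B)" if "x \<in> carrier Q8" for x
      unfolding carr using that by (simp add: S_def)
    show "\<psi> (x \<otimes>\<^bsub>Q8\<^esub> y) = \<psi> x \<otimes>\<^bsub>G\<lparr>carrier := \<Union>S\<rparr> Mod B\<^esub> \<psi> y" if "x \<in> carrier Q8" "y \<in> carrier Q8" for x y
      using \<psi>.hom_mult[OF that] by (simp add: FactGroup_def set_mult_def)
  qed
  then have "\<psi> \<in> iso Q8 (G\<lparr>carrier := \<Union>S\<rparr> Mod B)"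
    unfolding iso_iff carr using \<psi>(2) by (simp add: S_def)
  then have "G\<lparr>carrier := \<Union>S\<rparr> Mod B \<cong> Q8"
    using group.iso_set_sym[OF group_Q8] unfolding is_iso_def by blast
  moreover have "subgroup (\<Union>S) G"
    by (rule incl_subgroup[OF A U])
  ultimately show False
    using assms normal unfolding Q8_free_def by blast
qed

text \<open>The Frattini subgroup of a group of order 2 is trivial, so the hypothesis keeps
  \<open>t\<close> out of the commutator subgroup of \<open>{\<one>, t}\<close> with
  \<open>G\<close>. That subgroup is normal and serves as \<open>N\<close>.\<close>

lemma (in group) ic_phi_imp_involutions_split:
  assumes "\<And>H. subgroup H G \<Longrightarrow> card H = 2 \<Longrightarrow> ic_phi_subgroup H G"
  shows "involutions_split G"
  unfolding involutions_split_def
proof (intro ballI impI)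
  fix t assume t: "t \<in> carrier G" "t \<noteq> \<one>" "t \<otimes> t = \<one>"
  let ?H = "{\<one>, t}"
  have inv_t: "inv t = t"
    using t by (simp add: inv_equality)
  have H: "subgroup ?H G"
    using t inv_t by (intro subgroupI) auto
  then have ic: "?H \<inter> commutator_subgroup G ?H (carrier G) \<subseteq> frattini (G\<lparr>carrier := ?H\<rparr>)"
    using assms t(2) by (simp add: ic_phi_subgroup_def)
  have "maximal_subgroup {\<one>} (G\<lparr>carrier := ?H\<rparr>)"
  proof -
    have "K = {\<one>} \<or> K = ?H" if "subgroup K (G\<lparr>carrier := ?H\<rparr>)" for K
      using subgroup.subset[OF that] subgroup.one_closed[OF that] by auto
    then show ?thesis
      using t subgroup_incl[OF triv_subgroup H] by (auto simp: maximal_subgroup_def)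
  qed
  then have notin: "t \<notin> commutator_subgroup G ?H (carrier G)"
    using ic t(2) by (auto simp: frattini_def)
  let ?C = "\<Union>h\<in>?H. \<Union>k\<in>carrier G. {h \<otimes> k \<otimes> inv h \<otimes> inv k}"
  let ?N = "commutator_subgroup G ?H (carrier G)"
  have N: "?N = generate G ?C"
    by (simp add: commutator_subgroup_def)
  have C: "?C \<subseteq> carrier G"
    using t by auto
  have sub: "subgroup ?N G"
    unfolding N by (rule generate_is_subgroup[OF C])
  interpret N: subgroup ?N G by fact
  have comm: "h \<otimes> k \<otimes> inv h \<otimes> inv k \<in> ?N" if "h \<in> ?H" "k \<in> carrier G" for h k
    unfolding N by (rule generate.incl) (use that in blast)
  \<comment> \<open>Elements all of whose conjugates lie in \<open>?N\<close> form a subgroup, so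
    normality of \<open>?N\<close> need only be checked on the generating commutators.\<close>
  let ?M = "{n \<in> carrier G. \<forall>g\<in>carrier G. g \<otimes> n \<otimes> inv g \<in> ?N}"
  have M: "subgroup ?M G"
  proof (rule subgroupI)
    show "?M \<noteq> {}"
      using N.one_closed by (auto intro!: exI[of _ \<one>])
    show "inv a \<in> ?M" if "a \<in> ?M" for a
    proof -
      have "g \<otimes> inv a \<otimes> inv g = inv (g \<otimes> a \<otimes> inv g)" if "g \<in> carrier G" for g
        using that \<open>a \<in> ?M\<close> by (simp add: group_word)
      then show ?thesis
        using that by auto
    qed
    show "a \<otimes> b \<in> ?M" if "a \<in> ?M" "b \<in> ?M" for a b
    proof -
      have "g \<otimes> (a \<otimes> b) \<otimes> inv g = (g \<otimes> a \<otimes> inv g) \<otimes> (g \<otimes> b \<otimes> inv g)" if "g \<in> carrier G" for g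
        using that \<open>a \<in> ?M\<close> \<open>b \<in> ?M\<close> by (simp add: group_word)
      then show ?thesis
        using that N.m_closed by auto
    qed
  qed auto
  have "?C \<subseteq> ?M"
  proof
    fix n assume "n \<in> ?C"
    then obtain h k where hk: "h \<in> ?H" "k \<in> carrier G" "n = h \<otimes> k \<otimes> inv h \<otimes> inv k"
      by blast
    have h: "h \<in> carrier G"
      using hk(1) t(1) by auto
    \<comment> \<open>\<open>g [h, k] g\<inverse> = [h, g]\<inverse> [h, g k]\<close>\<close>
    have "g \<otimes> n \<otimes> inv g \<in> ?N" if g: "g \<in> carrier G" for g
    proof -
      have "g \<otimes> n \<otimes> inv g = inv (h \<otimes> g \<otimes> inv h \<otimes> inv g) \<otimes> (h \<otimes> (g \<otimes> k) \<otimes> inv h \<otimes> inv (g \<otimes> k))"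
        using g h hk(2) by (simp add: hk(3) group_word)
      then show ?thesis
        using comm[OF hk(1) g] comm[OF hk(1), of "g \<otimes> k"] g hk(2) by simp
    qed
    then show "n \<in> ?M"
      using hk(2,3) h by simp
  qed
  then have "generate G ?C \<subseteq> ?M"
    by (rule generate_subgroup_incl[OF _ M])
  then have "?N \<subseteq> ?M"
    by (simp only: N)
  then have "?N \<lhd> G"
    using sub by (auto simp: normal_inv_iff)
  then show "\<exists>N. N \<lhd> G \<and> t \<notin> N \<and> (\<forall>g\<in>carrier G. t \<otimes> g \<otimes> inv t \<otimes> inv g \<in> N)"
    using notin comm[of t] by blast
qed

lemma (in group) involutions_split_subgroup:
  assumes "involutions_split G" "subgroup H G"
  shows "involutions_split (G\<lparr>carrier := H\<rparr>)"
  unfolding involutions_split_def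
proof (intro ballI impI)
  interpret H: group "G\<lparr>carrier := H\<rparr>"
    using assms(2) by (rule subgroup_imp_group)
  interpret HG: subgroup H G by fact
  fix t assume t: "t \<in> carrier (G\<lparr>carrier := H\<rparr>)" "t \<noteq> \<one>\<^bsub>G\<lparr>carrier := H\<rparr>\<^esub>"
    "t \<otimes>\<^bsub>G\<lparr>carrier := H\<rparr>\<^esub> t = \<one>\<^bsub>G\<lparr>carrier := H\<rparr>\<^esub>"
  then have "t \<in> carrier G" "t \<noteq> \<one>" "t \<otimes> t = \<one>"
    by auto
  then obtain N where N: "N \<lhd> G" "t \<notin> N" "\<forall>g\<in>carrier G. t \<otimes> g \<otimes> inv t \<otimes> inv g \<in> N"
    using assms(1) unfolding involutions_split_def by blast
  have "N \<inter> H \<lhd> G\<lparr>carrier := H\<rparr>"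
    by (rule normal_Int_subgroup[OF assms(2) N(1)])
  moreover have "\<forall>g\<in>H. t \<otimes> g \<otimes> inv t \<otimes> inv g \<in> N \<inter> H"
    using N(3) t(1) by auto
  ultimately show "\<exists>N. N \<lhd> G\<lparr>carrier := H\<rparr> \<and> t \<notin> N \<and> (\<forall>g\<in>carrier (G\<lparr>carrier := H\<rparr>).
      t \<otimes>\<^bsub>G\<lparr>carrier := H\<rparr>\<^esub> g \<otimes>\<^bsub>G\<lparr>carrier := H\<rparr>\<^esub> inv\<^bsub>G\<lparr>carrier := H\<rparr>\<^esub> t \<otimes>\<^bsub>G\<lparr>carrier := H\<rparr>\<^esub> inv\<^bsub>G\<lparr>carrier := H\<rparr>\<^esub> g \<in> N)"
    using N(2) t(1) assms(2) by (intro exI[of _ "N \<inter> H"]) simp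
qed

lemma (in group) no_Q8_section_relations_subgroup:
  assumes "no_Q8_section_relations G" "subgroup H G"
  shows "no_Q8_section_relations (G\<lparr>carrier := H\<rparr>)"
  unfolding no_Q8_section_relations_def
proof (intro allI impI)
  fix A B i j
  let ?H = "G\<lparr>carrier := H\<rparr>"
  assume A: "subgroup A ?H" and B: "subgroup B ?H" "B \<subseteq> A"
    "\<forall>a\<in>A. \<forall>b\<in>B. a \<otimes>\<^bsub>?H\<^esub> b \<otimes>\<^bsub>?H\<^esub> inv\<^bsub>?H\<^esub> a \<in> B" and ij: "i \<in> A" "j \<in> A"
    and rel: "i \<otimes>\<^bsub>?H\<^esub> i \<otimes>\<^bsub>?H\<^esub> inv\<^bsub>?H\<^esub> (j \<otimes>\<^bsub>?H\<^esub> j) \<in> B"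
      "i \<otimes>\<^bsub>?H\<^esub> j \<otimes>\<^bsub>?H\<^esub> i \<otimes>\<^bsub>?H\<^esub> inv\<^bsub>?H\<^esub> j \<in> B"
  have AH: "A \<subseteq> H"
    using subgroup.subset[OF A] by simp
  have inv: "inv\<^bsub>?H\<^esub> a = inv a" if "a \<in> A" for a
    using m_inv_consistent[OF assms(2)] AH that by blast
  have "j \<otimes> j \<in> A"
    using subgroup.m_closed[OF A ij(2,2)] by simp
  then show "i \<otimes>\<^bsub>?H\<^esub> i \<in> B"
    using assms(1)[unfolded no_Q8_section_relations_def, rule_format, OF incl_subgroup[OF assms(2) A]
        incl_subgroup[OF assms(2) B(1)] B(2) _ ij] B(3) rel inv ij by simp
qed

section \<open>Quotients by normal subgroups of odd order\<close>

text \<open>The quotient is placed on coset representatives because the induction on the order of \<open>G\<close>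
  cannot change the type of the elements.\<close>

lemma (in group) quotient_on_representatives:
  assumes "N \<lhd> G"
  obtains Q :: "('a, 'b) monoid_scheme" and f :: "'a \<Rightarrow> 'a"
  where "group_hom G Q f" "f ` carrier G = carrier Q" "kernel G Q f = N"
proof -
  interpret N: normal N G by fact
  obtain r where r: "\<And>g. g \<in> carrier G \<Longrightarrow> r g \<in> carrier G"
    "\<And>g h. g \<in> carrier G \<Longrightarrow> h \<in> carrier G \<Longrightarrow> r g = r h \<longleftrightarrow> inv g \<otimes> h \<in> N"
    "\<And>g. g \<in> carrier G \<Longrightarrow> r (r g) = r g"
    using coset_representatives[OF N.subgroup_axioms] by blast
  have r_mult: "r (g \<otimes> h) = r (r g \<otimes> r h)" if "g \<in> carrier G" "h \<in> carrier G" for g h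
  proof -
    have "inv g \<otimes> r g \<in> N" "inv h \<otimes> r h \<in> N"
      using that r(1) r(3)[of g] r(3)[of h] r(2)[of g "r g"] r(2)[of h "r h"] by simp_all
    then have "(inv h \<otimes> (inv g \<otimes> r g) \<otimes> h) \<otimes> (inv h \<otimes> r h) \<in> N"
      using that N.inv_op_closed1 by simp
    moreover have "(inv h \<otimes> (inv g \<otimes> r g) \<otimes> h) \<otimes> (inv h \<otimes> r h) = inv (g \<otimes> h) \<otimes> (r g \<otimes> r h)"
      using that r(1) by (simp add: group_word)
    ultimately show ?thesis
      using that r(1) r(2)[of "g \<otimes> h" "r g \<otimes> r h"] by simp
  qed
  \<comment> \<open>With carrier \<open>UNIV\<close>, a homomorphism into \<open>?M\<close> is just
    a multiplicative map; the group axioms for \<open>?Q\<close> are then inherited from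
    \<open>G\<close> along \<open>r\<close>.\<close>
  let ?M = "G\<lparr>carrier := UNIV, monoid.mult := \<lambda>x y. r (x \<otimes> y)\<rparr>"
  let ?Q = "?M\<lparr>carrier := r ` carrier G, one := r \<one>\<rparr>"
  have hom: "r \<in> hom G ?M"
    using r_mult by (auto simp: hom_def)
  have "group ?Q"
    by (rule hom_imp_img_group[OF hom])
  moreover have "r \<in> hom G ?Q"
    using r_mult by (auto simp: hom_def)
  ultimately have "group_hom G ?Q r"
    using is_group by (simp add: group_hom_def group_hom_axioms_def)
  moreover have "r ` carrier G = carrier ?Q"
    by simp
  moreover have "kernel G ?Q r = N"
  proof -
    have "r x = r \<one> \<longleftrightarrow> x \<in> N" if "x \<in> carrier G" for x
      using r(2)[OF one_closed that] that by (simp add: eq_commute[of "r x"])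
    then show ?thesis
      using N.subset by (auto simp: kernel_def)
  qed
  ultimately show thesis
    by (rule that)
qed

context group_hom
begin

lemma vimage_subgroup:
  assumes "subgroup S H"
  shows "subgroup {g \<in> carrier G. h g \<in> S} G"
proof -
  interpret S: subgroup S H by fact
  show ?thesis
    by (rule G.subgroupI) auto
qed

lemma card_vimage_kernel:
  assumes "finite (carrier G)" "S \<subseteq> h ` carrier G"
  shows "card {g \<in> carrier G. h g \<in> S} = card S * card (kernel G H h)"
proof -
  have "card {g \<in> carrier G. h g = y} = card (kernel G H h)" if y: "y \<in> S" for y
  proof -
    obtain g where g: "g \<in> carrier G" "y = h g"
      using y assms(2) by blast
    have "bij_betw ((\<otimes>) g) (kernel G H h) {x \<in> carrier G. h x = y}"
      by (rule bij_betw_byWitness[where f' = "(\<otimes>) (inv g)"])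
        (use g in \<open>auto simp: kernel_def G.inv_mult_cancel_left G.mult_inv_cancel_left\<close>)
    then show ?thesis
      using bij_betw_same_card by metis
  qed
  moreover have "{g \<in> carrier G. h g \<in> S} = (\<Union>y\<in>S. {g \<in> carrier G. h g = y})"
    by auto
  moreover have "finite S"
    using assms finite_surj by blast
  moreover have "card (\<Union>y\<in>S. {g \<in> carrier G. h g = y}) = (\<Sum>y\<in>S. card {g \<in> carrier G. h g = y})"
    using assms(1) \<open>finite S\<close> by (intro card_UN_disjoint) auto
  ultimately show ?thesis
    by simp
qed

text \<open>The preimage of the complement keeps its index, and its order only gains the odd factor
  contributed by the kernel.\<close>

lemma p_nilpotent_two_if_image:
  assumes fin: "finite (carrier G)" and surj: "h ` carrier G = carrier H"
    and odd: "odd (card (kernel G H h))" and nilp: "p_nilpotent 2 H"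
  shows "p_nilpotent 2 G"
proof -
  have "finite (carrier H)"
    using fin surj by (metis finite_imageI)
  then obtain N where N: "normal_two_complement H (carrier H) N"
    using nilp H.p_nilpotent_two_iff by blast
  then have N': "subgroup N H" "N \<subseteq> carrier H" "\<forall>x\<in>carrier H. \<forall>n\<in>N. x \<otimes>\<^bsub>H\<^esub> n \<otimes>\<^bsub>H\<^esub> inv\<^bsub>H\<^esub> x \<in> N" "odd (card N)"
    by (simp_all add: normal_two_complement_def)
  obtain k where k: "card (carrier H) = card N * 2 ^ k"
    using N by (auto simp: normal_two_complement_def)
  let ?N = "{g \<in> carrier G. h g \<in> N}"
  have "card ?N = card N * card (kernel G H h)"
    using card_vimage_kernel[OF fin, of N] N'(2) surj by simp
  moreover have "card (carrier G) = card (carrier H) * card (kernel G H h)"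
  proof -
    have "{g \<in> carrier G. h g \<in> carrier H} = carrier G"
      by auto
    then show ?thesis
      using card_vimage_kernel[OF fin, of "carrier H"] by (simp add: surj)
  qed
  moreover have "subgroup ?N G"
    by (rule vimage_subgroup[OF N'(1)])
  ultimately have "normal_two_complement G (carrier G) ?N"
    using N'(3,4) odd k by (auto simp: normal_two_complement_def)
  then show ?thesis
    using G.p_nilpotent_two_iff[OF fin] by blast
qed

lemma no_Q8_section_relations_image:
  assumes surj: "h ` carrier G = carrier H" and G: "no_Q8_section_relations G"
  shows "no_Q8_section_relations H"
  unfolding no_Q8_section_relations_def
proof (intro allI impI)
  fix A B i j
  assume A: "subgroup A H" and B: "subgroup B H" "B \<subseteq> A" "\<forall>a\<in>A. \<forall>b\<in>B. a \<otimes>\<^bsub>H\<^esub> b \<otimes>\<^bsub>H\<^esub> inv\<^bsub>H\<^esub> a \<in> B"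
    and ij: "i \<in> A" "j \<in> A" and rel: "i \<otimes>\<^bsub>H\<^esub> i \<otimes>\<^bsub>H\<^esub> inv\<^bsub>H\<^esub> (j \<otimes>\<^bsub>H\<^esub> j) \<in> B" "i \<otimes>\<^bsub>H\<^esub> j \<otimes>\<^bsub>H\<^esub> i \<otimes>\<^bsub>H\<^esub> inv\<^bsub>H\<^esub> j \<in> B"
  obtain i' where i': "i' \<in> carrier G" "h i' = i"
    using subgroup.mem_carrier[OF A ij(1)] surj by (metis imageE)
  obtain j' where j': "j' \<in> carrier G" "h j' = j"
    using subgroup.mem_carrier[OF A ij(2)] surj by (metis imageE)
  have "i' \<otimes> i' \<in> {g \<in> carrier G. h g \<in> B}"
    by (rule G[unfolded no_Q8_section_relations_def, rule_format, OF vimage_subgroup[OF A] vimage_subgroup[OF B(1)],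
          where j = j']) (use B i' j' ij rel in auto)
  then show "i \<otimes>\<^bsub>H\<^esub> i \<in> B"
    using i' by simp
qed

lemma involutions_split_image:
  assumes surj: "h ` carrier G = carrier H" and odd: "odd (card (kernel G H h))"
    and G: "involutions_split G"
  shows "involutions_split H"
  unfolding involutions_split_def
proof (intro ballI impI)
  fix t assume t: "t \<in> carrier H" "t \<noteq> \<one>\<^bsub>H\<^esub>" "t \<otimes>\<^bsub>H\<^esub> t = \<one>\<^bsub>H\<^esub>"
  let ?m = "card (kernel G H h)"
  obtain q where q: "?m = Suc (2 * q)"
    using odd by (metis oddE Suc_eq_plus1)
  have even_pow: "y [^]\<^bsub>H\<^esub> (2 * q) = \<one>\<^bsub>H\<^esub>" if "y \<in> carrier H" "y \<otimes>\<^bsub>H\<^esub> y = \<one>\<^bsub>H\<^esub>" for y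
  proof -
    have "y [^]\<^bsub>H\<^esub> (2::nat) = \<one>\<^bsub>H\<^esub>"
      using that by (simp add: numeral_2_eq_2)
    then show ?thesis
      using that(1) by (simp flip: H.nat_pow_pow)
  qed
  obtain t0 where t0: "t0 \<in> carrier G" "h t0 = t"
    using t(1) surj by (metis imageE)
  define u where "u = t0 [^] ?m"
  have u: "u \<in> carrier G"
    using t0(1) by (simp add: u_def)
  have "t0 \<otimes> t0 \<in> kernel G H h"
    using t0 t(3) by (simp add: kernel_def)
  then have "(t0 \<otimes> t0) [^] ?m = \<one>"
    by (rule G.subgroup_pow_card[OF subgroup_kernel])
  then have uu: "u \<otimes> u = \<one>"
    using t0(1) by (simp add: u_def G.pow_mult_distrib)
  have hu: "h u = t"
    using t0 t(1) even_pow[OF t(1,3)] by (simp add: u_def hom_nat_pow q)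
  have "u \<noteq> \<one>"
    using hu t(2) by auto
  then obtain N where N: "N \<lhd> G" "u \<notin> N" "\<forall>g\<in>carrier G. u \<otimes> g \<otimes> inv u \<otimes> inv g \<in> N"
    using G u uu unfolding involutions_split_def by blast
  interpret N: normal N G by fact
  have "h ` N \<lhd> H"
    by (rule N.surj_hom_normal_subgroup[OF group_hom_axioms surj])
  moreover have "t \<notin> h ` N"
  proof
    assume "t \<in> h ` N"
    then obtain n where n: "n \<in> N" "h n = t"
      by blast
    have nc: "n \<in> carrier G"
      using n(1) by simp
    define w where "w = inv n \<otimes> u"
    have w: "w \<in> carrier G"
      using nc u by (simp add: w_def)
    have "w \<in> kernel G H h"
      using n nc u hu t(1) by (simp add: w_def kernel_def)
    then have w_pow: "w [^] ?m = \<one>"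
      by (rule G.subgroup_pow_card[OF subgroup_kernel])
    \<comment> \<open>Since \<open>w = inv n \<otimes> u\<close> with \<open>n\<close> in
      \<open>N\<close>, equal powers of \<open>w\<close> and \<open>u\<close> agree modulo
      \<open>N\<close>.\<close>
    have "w [^] k \<otimes> inv (u [^] k) \<in> N" for k :: nat
    proof (induct k)
      case (Suc k)
      have "w [^] Suc k \<otimes> inv (u [^] Suc k) =
          (w [^] k \<otimes> inv (u [^] k)) \<otimes> (u [^] k \<otimes> inv n \<otimes> inv (u [^] k))"
        using nc u by (simp add: w_def G.group_word)
      then show ?case
        using Suc N.inv_op_closed2[of "u [^] k" "inv n"] n(1) u by simp
    qed simp
    from this[of ?m] have "inv (u [^] ?m) \<in> N"
      using u by (simp add: w_pow)
    moreover have "u [^] ?m = u"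
    proof -
      have "u [^] (2::nat) = \<one>"
        using u uu by (simp add: numeral_2_eq_2)
      then have "u [^] (2 * q) = \<one>"
        using u by (simp flip: G.nat_pow_pow)
      then show ?thesis
        using u by (simp add: q)
    qed
    ultimately show False
      using N(2) u N.m_inv_closed[of "inv u"] by simp
  qed
  moreover have "\<forall>g\<in>carrier H. t \<otimes>\<^bsub>H\<^esub> g \<otimes>\<^bsub>H\<^esub> inv\<^bsub>H\<^esub> t \<otimes>\<^bsub>H\<^esub> inv\<^bsub>H\<^esub> g \<in> h ` N"
  proof
    fix y assume "y \<in> carrier H"
    then obtain g where g: "g \<in> carrier G" "y = h g"
      using surj by (metis imageE)
    have "t \<otimes>\<^bsub>H\<^esub> y \<otimes>\<^bsub>H\<^esub> inv\<^bsub>H\<^esub> t \<otimes>\<^bsub>H\<^esub> inv\<^bsub>H\<^esub> y = h (u \<otimes> g \<otimes> inv u \<otimes> inv g)"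
      using g u hu by simp
    then show "t \<otimes>\<^bsub>H\<^esub> y \<otimes>\<^bsub>H\<^esub> inv\<^bsub>H\<^esub> t \<otimes>\<^bsub>H\<^esub> inv\<^bsub>H\<^esub> y \<in> h ` N"
      using N(3) g(1) by blast
  qed
  ultimately show "\<exists>N. N \<lhd> H \<and> t \<notin> N \<and> (\<forall>g\<in>carrier H. t \<otimes>\<^bsub>H\<^esub> g \<otimes>\<^bsub>H\<^esub> inv\<^bsub>H\<^esub> t \<otimes>\<^bsub>H\<^esub> inv\<^bsub>H\<^esub> g \<in> N)"
    by blast
qed

end

section \<open>Minimal counterexamples\<close>

context group
begin

lemma normal_centralizer:
  assumes "S \<lhd> G"
  shows "{g \<in> carrier G. \<forall>s\<in>S. g \<otimes> s = s \<otimes> g} \<lhd> G"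
proof -
  interpret S: normal S G by fact
  let ?C = "{g \<in> carrier G. \<forall>s\<in>S. g \<otimes> s = s \<otimes> g}"
  have "subgroup ?C G"
  proof (rule subgroupI)
    show "?C \<noteq> {}"
      by (auto intro!: exI[of _ \<one>])
    show "inv a \<in> ?C" if "a \<in> ?C" for a
      using that commute_inv[of a] by auto
    show "a \<otimes> b \<in> ?C" if "a \<in> ?C" "b \<in> ?C" for a b
    proof -
      have "a \<otimes> b \<otimes> s = s \<otimes> (a \<otimes> b)" if s: "s \<in> S" for s
      proof -
        have "a \<otimes> b \<otimes> s = a \<otimes> (s \<otimes> b)"
          using \<open>a \<in> ?C\<close> \<open>b \<in> ?C\<close> s by (simp add: m_assoc)
        also have "\<dots> = s \<otimes> a \<otimes> b"
          using \<open>a \<in> ?C\<close> \<open>b \<in> ?C\<close> s by (simp flip: m_assoc)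
        finally show ?thesis
          using \<open>a \<in> ?C\<close> \<open>b \<in> ?C\<close> s by (simp add: m_assoc)
      qed
      then show ?thesis
        using that by simp
    qed
  qed auto
  moreover have "x \<otimes> c \<otimes> inv x \<in> ?C" if x: "x \<in> carrier G" and c: "c \<in> ?C" for x c
  proof -
    have "x \<otimes> c \<otimes> inv x \<otimes> s = s \<otimes> (x \<otimes> c \<otimes> inv x)" if s: "s \<in> S" for s
    proof -
      have "c \<otimes> (inv x \<otimes> s \<otimes> x) = (inv x \<otimes> s \<otimes> x) \<otimes> c"
        using c S.inv_op_closed1[OF x s] by simp
      then have "x \<otimes> (c \<otimes> (inv x \<otimes> s \<otimes> x)) \<otimes> inv x = x \<otimes> ((inv x \<otimes> s \<otimes> x) \<otimes> c) \<otimes> inv x"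
        by simp
      then show ?thesis
        using x c s by (simp add: group_word)
    qed
    then show ?thesis
      using x c by simp
  qed
  ultimately show ?thesis
    by (auto simp: normal_inv_iff)
qed

text \<open>A Sylow subgroup for an odd prime divisor of the order supplies the element.\<close>

lemma exists_odd_ord:
  assumes "finite (carrier G)" "\<And>k. order G \<noteq> 2 ^ k"
  obtains x where "x \<in> carrier G" "x \<noteq> \<one>" "odd (ord x)"
proof -
  have "order G > 0"
    using assms(1) by (simp add: order_gt_0_iff_finite)
  then obtain m where m: "order G = 2 ^ multiplicity 2 (order G) * m" "\<not> 2 dvd m"
    using multiplicity_decompose'[of "order G" 2] by auto
  then have "m \<noteq> 1"
    using assms(2) by (metis mult.right_neutral)
  then obtain p where p: "Factorial_Ring.prime p" "p dvd m"
    using prime_factor_nat by blast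
  then have "p dvd order G"
    by (subst m(1)) simp
  then obtain l where "order G = p ^ 1 * l"
    by auto
  then obtain H where H: "subgroup H G" "card H = p ^ 1"
    using sylow_thm[OF p(1) is_group _ assms(1)] by blast
  have "odd p"
    using p(2) m(2) dvd_trans by blast
  have "H \<noteq> {\<one>}"
    using H(2) p(1) by auto
  then obtain x where x: "x \<in> H" "x \<noteq> \<one>"
    using subgroup.one_closed[OF H(1)] by blast
  moreover have "odd (ord x)"
    using ord_dvd_card_subgroup[OF H(1) x(1)] H(2) \<open>odd p\<close> dvd_trans by auto
  moreover have "x \<in> carrier G"
    by (rule subgroup.mem_carrier[OF H(1) x(1)])
  ultimately show thesis
    using that by blast
qed

text \<open>Here \<open>z\<close> is the commutator of \<open>g\<close> and \<open>h\<close>. Moving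
  \<open>g \<otimes> g\<close> past \<open>h\<close> one factor at a time produces
  \<open>z \<otimes> z\<close>, although \<open>g \<otimes> g\<close> commutes with
  \<open>h\<close>.\<close>

lemma commutator_square_trivial:
  assumes c: "g \<in> carrier G" "h \<in> carrier G" "z \<in> carrier G"
    and z: "g \<otimes> h = z \<otimes> (h \<otimes> g)" "g \<otimes> z = z \<otimes> g"
    and gg: "g \<otimes> g \<otimes> h = h \<otimes> (g \<otimes> g)"
  shows "z \<otimes> z = \<one>"
proof -
  have "g \<otimes> g \<otimes> h = g \<otimes> (z \<otimes> (h \<otimes> g))"
    using c by (simp add: m_assoc z(1))
  also have "\<dots> = (g \<otimes> z) \<otimes> (h \<otimes> g)"
    using c by (simp add: m_assoc)
  also have "\<dots> = z \<otimes> (g \<otimes> h) \<otimes> g"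
    using c by (simp add: z(2) m_assoc)
  also have "\<dots> = (z \<otimes> z) \<otimes> (h \<otimes> (g \<otimes> g))"
    using c by (simp add: z(1) m_assoc)
  finally have "(z \<otimes> z) \<otimes> (h \<otimes> (g \<otimes> g)) = \<one> \<otimes> (h \<otimes> (g \<otimes> g))"
    using c gg by simp
  then show ?thesis
    using c by (simp del: l_one)
qed

end

text \<open>What minimality of the order provides: \<open>proper\<close> comes from applying it to
  subgroups, \<open>no_odd_normal\<close> from quotients.\<close>

locale minimal_non_two_nilpotent = group +
  assumes fin: "finite (carrier G)"
    and proper: "\<And>H. subgroup H G \<Longrightarrow> H \<noteq> carrier G \<Longrightarrow> \<exists>K. normal_two_complement G H K"
    and no_complement: "\<And>K. \<not> normal_two_complement G (carrier G) K"
    and no_odd_normal: "\<And>N. N \<lhd> G \<Longrightarrow> odd (card N) \<Longrightarrow> N = {\<one>}"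
begin

text \<open>The complement of \<open>N\<close> consists of its elements of odd order, so it is
  normal in \<open>G\<close> and hence trivial.\<close>

lemma proper_normal_card:
  assumes "N \<lhd> G" "N \<noteq> carrier G"
  obtains k where "card N = 2 ^ k"
proof -
  interpret N: normal N G by fact
  obtain K where K: "normal_two_complement G N K"
    using proper[OF N.subgroup_axioms assms(2)] by blast
  then have K': "subgroup K G" "K \<subseteq> N" "odd (card K)"
    by (auto simp: normal_two_complement_def)
  have mem: "x \<in> K \<longleftrightarrow> odd (ord x)" if "x \<in> N" for x
    by (rule normal_two_complement_mem_iff[OF fin N.subgroup_axioms K that])
  have "g \<otimes> x \<otimes> inv g \<in> K" if g: "g \<in> carrier G" and x: "x \<in> K" for g x
  proof -
    have "x \<in> N"
      using x K'(2) by blast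
    then show ?thesis
      using mem[of "g \<otimes> x \<otimes> inv g"] mem[of x] x g N.inv_op_closed2[OF g] by (simp add: ord_conj)
  qed
  then have "K \<lhd> G"
    using K'(1) by (auto simp: normal_inv_iff)
  then have "K = {\<one>}"
    using no_odd_normal K'(3) by blast
  then show thesis
    using K that by (auto simp: normal_two_complement_def)
qed

lemma order_not_two_power: "order G \<noteq> 2 ^ k"
proof
  assume "order G = 2 ^ k"
  then have "normal_two_complement G (carrier G) {\<one>}"
    using triv_subgroup by (auto simp: normal_two_complement_def order_def)
  then show False
    using no_complement by blast
qed

lemma normal_with_odd_ord_eq:
  assumes "N \<lhd> G" "x \<in> N" "x \<noteq> \<one>" "odd (ord x)"
  shows "N = carrier G"
proof (rule ccontr)
  assume "N \<noteq> carrier G"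
  then obtain k where "card N = 2 ^ k"
    using proper_normal_card[OF assms(1)] by blast
  then show False
    using odd_ord_two_pow_trivial[OF normal_imp_subgroup[OF assms(1)] _ assms(2,4)] assms(3) by blast
qed

lemma no_normal_index_two:
  assumes "N \<lhd> G"
  shows "order G \<noteq> 2 * card N"
proof
  assume ord: "order G = 2 * card N"
  then have "N \<noteq> carrier G"
    using fin order_gt_0_iff_finite by (auto simp: order_def)
  then obtain k where "card N = 2 ^ k"
    using proper_normal_card[OF assms] by blast
  then have "order G = 2 ^ Suc k"
    using ord by simp
  then show False
    using order_not_two_power by blast
qed

text \<open>If the product of \<open>P\<close> and the subgroup generated by \<open>x\<close> is
  proper, its normal 2-complement contains \<open>x\<close> and centralizes
  \<open>P\<close>.\<close>

lemma commutes_with_normal_two_subgroup_or_generates: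
  assumes "P \<lhd> G" "card P = 2 ^ k" "x \<in> carrier G" "odd (ord x)"
  shows "(\<forall>p\<in>P. x \<otimes> p = p \<otimes> x) \<or> (\<forall>g\<in>carrier G. \<exists>p\<in>P. \<exists>j::int. g = p \<otimes> x [^] j)"
proof -
  interpret P: normal P G by fact
  let ?H = "P <#> generate G {x}"
  have gen: "generate G {x} = {x [^] (j::int) |j. j \<in> UNIV}"
    by (rule generate_pow[OF assms(3)])
  have H: "subgroup ?H G"
    using assms(3) by (intro mult_norm_subgroup[OF assms(1)] generate_is_subgroup) simp
  show ?thesis
  proof (cases "?H = carrier G")
    case True
    then show ?thesis
      by (auto simp: gen set_mult_def)
  next
    case False
    obtain K where K: "normal_two_complement G ?H K"
      using proper[OF H False] by blast
    have xg: "x \<in> generate G {x}"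
      by (rule generate.incl) simp
    then have "\<one> \<otimes> x \<in> ?H"
      using P.one_closed unfolding set_mult_def by blast
    then have "x \<in> ?H"
      using assms(3) by simp
    then have xK: "x \<in> K"
      using normal_two_complement_mem_iff[OF fin H K] assms(4) by blast
    have "P \<subseteq> ?H"
    proof
      fix p assume "p \<in> P"
      then have "p \<otimes> \<one> \<in> ?H"
        using generate.one[of G "{x}"] unfolding set_mult_def by blast
      then show "p \<in> ?H"
        using \<open>p \<in> P\<close> by simp
    qed
    moreover have "?H \<subseteq> normalizing G P"
      using subgroup.mem_carrier[OF H] P.inv_op_closed2 by (auto intro: normalizingI[OF fin P.subset])
    ultimately show ?thesis
      using complement_commutes_with_normal_two_subgroup[OF fin P.subgroup_axioms assms(2) K _ _ xK] by blast
  qed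
qed

text \<open>The centralizer of \<open>S\<close> is normal and contains a nontrivial element of odd
  order, so it is everything.\<close>

lemma centralized_by_odd_ord_imp_central:
  assumes "S \<lhd> G" "x \<in> carrier G" "x \<noteq> \<one>" "odd (ord x)" "\<And>s. s \<in> S \<Longrightarrow> x \<otimes> s = s \<otimes> x"
    and "s \<in> S" "g \<in> carrier G"
  shows "g \<otimes> s = s \<otimes> g"
proof -
  have "{g \<in> carrier G. \<forall>s\<in>S. g \<otimes> s = s \<otimes> g} = carrier G"
    by (rule normal_with_odd_ord_eq[OF normal_centralizer[OF assms(1)] _ assms(3,4)]) (use assms(2,5) in blast)
  then show ?thesis
    using assms(6,7) by blast
qed

lemma exists_noncentral_normal_two_subgroup:
  "\<exists>P k. P \<lhd> G \<and> card P = 2 ^ k \<and> \<not> (\<forall>p\<in>P. \<forall>g\<in>carrier G. g \<otimes> p = p \<otimes> g)"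
proof (rule ccontr)
  assume contra: "\<not> ?thesis"
  let ?Z = "{z \<in> carrier G. \<forall>g\<in>carrier G. g \<otimes> z = z \<otimes> g}"
  have local: "\<exists>K. normal_two_complement G (normalizing G D) K"
    if D: "subgroup D G" "card D = 2 ^ k" "\<not> D \<subseteq> ?Z" for D k
  proof (rule proper)
    show "subgroup (normalizing G D) G"
      by (rule subgroup_normalizing[OF subgroup.subset[OF D(1)]])
    show "normalizing G D \<noteq> carrier G"
    proof
      assume "normalizing G D = carrier G"
      then have "D \<lhd> G"
        using D(1) normalizingD(2) by (auto simp: normal_inv_iff)
      then have "\<forall>p\<in>D. \<forall>g\<in>carrier G. g \<otimes> p = p \<otimes> g"
        using contra D(2) by blast
      then show False
        using D(3) subgroup.subset[OF D(1)] by blast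
    qed
  qed
  have pos: "order G > 0"
    using fin by (simp add: order_gt_0_iff_finite)
  then obtain m where m: "order G = 2 ^ multiplicity 2 (order G) * m" "odd m"
    using multiplicity_decompose'[of "order G" 2] by auto
  define a where "a = multiplicity 2 (order G)"
  have ord: "order G = 2 ^ a * m"
    using m(1) by (simp add: a_def)
  \<comment> \<open>Were the order odd, \<open>G\<close> would be a normal subgroup of odd order of
    itself, hence trivial.\<close>
  have "a \<noteq> 0"
  proof
    assume "a = 0"
    then have "carrier G = {\<one>}"
      using no_odd_normal[of "carrier G"] ord m(2) subgroup_self by (auto simp: order_def normal_inv_iff)
    then show False
      using order_not_two_power[of 0] by (simp add: order_def)
  qed
  then obtain b where a: "a = Suc b"
    by (cases a) auto
  obtain T where T: "subgroup T G" "card T = 2 ^ a"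
    using sylow_thm[OF two_is_prime_nat is_group ord fin] by blast
  have finT: "finite T"
    using fin subgroup.subset[OF T(1)] by (rule finite_subset[rotated])
  \<comment> \<open>Sylow's existence theorem is used in \<open>T\<close> with cofactor 2, which
    gives a subgroup of index 2.\<close>
  then obtain K where K0: "subgroup K (G\<lparr>carrier := T\<rparr>)" "card K = 2 ^ b"
    using sylow_thm[OF two_is_prime_nat subgroup_imp_group[OF T(1)], of b 2] T(2) a by (auto simp: order_def)
  have K: "subgroup K G" "K \<subseteq> T" "card T = 2 * card K"
    using incl_subgroup[OF T(1) K0(1)] subgroup.subset[OF K0(1)] K0(2) T(2) a by auto
  note half = half_subgroup_mult_iff[OF fin K(1) T(1) K(2,3)]
  have "\<exists>N. N \<lhd> G \<and> order G = 2 * card N"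
  proof (rule transfer_normal_subgroup_index_two[OF fin T(1) _ m(2) K half])
    show "order G = card T * m"
      using ord T(2) by simp
    show "inv x \<otimes> v \<otimes> x \<in> K \<longleftrightarrow> v \<in> K" if x: "x \<in> carrier G" and v: "v \<in> T" "inv x \<otimes> v \<otimes> x \<in> T" for x v
    proof -
      have "\<exists>t\<in>T. inv x \<otimes> v \<otimes> inv (inv x) = t \<otimes> v \<otimes> inv t"
        by (rule sylow_controls_fusion[OF fin ord m(2) local _ T]) (use x v in auto)
      then obtain t where t: "t \<in> T" "inv x \<otimes> v \<otimes> x = t \<otimes> v \<otimes> inv t"
        using x by auto
      \<comment> \<open>\<open>t\<close> and \<open>inv t\<close> have the same parity with respect
        to \<open>K\<close>, so conjugation by \<open>t\<close> preserves membership in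
        \<open>K\<close>.\<close>
      have "t \<otimes> inv t \<in> K"
        using t(1) subgroup.one_closed[OF K(1)] subgroup.mem_carrier[OF T(1)] by simp
      then have "t \<in> K \<longleftrightarrow> inv t \<in> K"
        using half[OF t(1) subgroup.m_inv_closed[OF T(1) t(1)]] by simp
      then show ?thesis
        using half[OF t(1) v(1)] half[OF subgroup.m_closed[OF T(1) t(1) v(1)] subgroup.m_inv_closed[OF T(1) t(1)]]
        by (auto simp: t(2))
    qed
  qed
  then show False
    using no_normal_index_two by blast
qed

end

section \<open>Extracting a quaternion section\<close>

text \<open>Conjugating \<open>g\<close> by \<open>x [^] n\<close> multiplies it by
  \<open>c [^] n\<close>. For \<open>n = ord x\<close> this shows that the order of \<open>c\<close>
  is odd, while \<open>c\<close> lies in a 2-group.\<close>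

lemma (in group) odd_ord_centralized_by_two_subgroup_element_trivial:
  assumes "subgroup P G" "card P = 2 ^ k" "c \<in> P" "g \<in> carrier G" "x \<in> carrier G" "odd (ord x)"
    and "x \<otimes> c = c \<otimes> x" "x \<otimes> g \<otimes> inv x = c \<otimes> g"
  shows "c = \<one>"
proof -
  have c: "c \<in> carrier G"
    by (rule subgroup.mem_carrier[OF assms(1,3)])
  have "x [^] n \<otimes> g \<otimes> inv (x [^] n) = c [^] n \<otimes> g" for n :: nat
  proof (induct n)
    case 0
    then show ?case
      using assms(4) by simp
  next
    case (Suc n)
    have xc: "x \<otimes> c [^] n = c [^] n \<otimes> x"
    proof (induct n)
      case (Suc n)
      have "x \<otimes> c [^] Suc n = (x \<otimes> c [^] n) \<otimes> c"
        using c assms(5) by (simp add: m_assoc)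
      also have "\<dots> = c [^] n \<otimes> (x \<otimes> c)"
        using c assms(5) by (simp add: Suc m_assoc)
      finally show ?case
        using c assms(5,7) by (simp add: m_assoc)
    qed (use assms(5) in simp)
    have "x [^] Suc n \<otimes> g \<otimes> inv (x [^] Suc n) = x \<otimes> (x [^] n \<otimes> g \<otimes> inv (x [^] n)) \<otimes> inv x"
      using assms(4,5) by (simp only: nat_pow_Suc2) (simp add: group_word)
    also have "\<dots> = (x \<otimes> c [^] n) \<otimes> g \<otimes> inv x"
      using assms(4,5) c by (simp add: Suc m_assoc)
    also have "\<dots> = c [^] n \<otimes> (x \<otimes> g \<otimes> inv x)"
      using assms(4,5) c by (simp add: xc m_assoc)
    also have "\<dots> = c [^] Suc n \<otimes> g"
      using assms(4,5) c by (simp add: assms(8) m_assoc)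
    finally show ?case .
  qed
  from this[of "ord x"] have "c [^] ord x \<otimes> g = \<one> \<otimes> g"
    using assms(4,5) by simp
  then have "c [^] ord x = \<one>"
    using assms(4) c by (simp del: l_one)
  then have "ord c dvd ord x"
    using c by (simp add: pow_eq_id)
  then have "odd (ord c)"
    using assms(6) dvd_trans by blast
  then show ?thesis
    by (rule odd_ord_two_pow_trivial[OF assms(1-3)])
qed

lemma (in minimal_non_two_nilpotent) not_involutions_split_without_Q8_section:
  assumes split: "involutions_split G" and Q8: "no_Q8_section_relations G"
  shows False
proof -
  obtain P k where P: "P \<lhd> G" "card P = 2 ^ k" "\<not> (\<forall>p\<in>P. \<forall>g\<in>carrier G. g \<otimes> p = p \<otimes> g)"
    using exists_noncentral_normal_two_subgroup by blast
  interpret P: normal P G by fact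

  \<comment> \<open>The action of an element of odd order on \<open>P\<close>\<close>
  obtain x p0 where x: "x \<in> carrier G" "odd (ord x)" and p0: "p0 \<in> P" "x \<otimes> p0 \<noteq> p0 \<otimes> x"
  proof -
    obtain x where x: "x \<in> carrier G" "x \<noteq> \<one>" "odd (ord x)"
      using exists_odd_ord[OF fin order_not_two_power] by blast
    have "\<not> (\<forall>p\<in>P. x \<otimes> p = p \<otimes> x)"
      using centralized_by_odd_ord_imp_central[OF P(1) x] P(3) by blast
    then show thesis
      using that x by blast
  qed
  have x1: "x \<noteq> \<one>"
    using p0 by auto
  note Pc = P.mem_carrier
  note trivial = odd_ord_centralized_by_two_subgroup_element_trivial[OF P.subgroup_axioms P(2) _ _ x]
  have central: "g \<otimes> s = s \<otimes> g" if S: "S \<lhd> G" "S \<subseteq> P" "S \<noteq> P" and "s \<in> S" "g \<in> carrier G" for S s g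
  proof -
    interpret S: normal S G by fact
    obtain i where i: "card S = 2 ^ i"
      using subgroup_of_two_subgroup[OF S.subgroup_axioms P.subgroup_axioms S(2) P(2)] by blast
    have "\<forall>s\<in>S. x \<otimes> s = s \<otimes> x"
    proof (rule ccontr)
      assume "\<not> ?thesis"
      \<comment> \<open>If \<open>x\<close> does not centralize \<open>S\<close>, then
        \<open>S\<close> and \<open>x\<close> generate \<open>G\<close>. Writing an element of
        \<open>P\<close> as \<open>s \<otimes> x [^] j\<close> makes \<open>x [^] j\<close> an
        element of \<open>P\<close> of odd order, hence trivial, so
        \<open>P \<subseteq> S\<close>.\<close>
      then have gen': "\<exists>s\<in>S. \<exists>j::int. g = s \<otimes> x [^] j" if "g \<in> carrier G" for g
        using commutes_with_normal_two_subgroup_or_generates[OF S(1) i x] that by blast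
      have "p \<in> S" if p: "p \<in> P" for p
      proof -
        obtain s j where sj: "s \<in> S" "p = s \<otimes> x [^] (j::int)"
          using gen'[OF Pc[OF p]] by blast
        have "inv s \<otimes> p = x [^] j"
          using sj x(1) by (simp add: inv_mult_cancel_left)
        moreover have "inv s \<otimes> p \<in> P"
          using sj(1) p S(2) by auto
        ultimately have xj: "x [^] j \<in> P"
          by simp
        have "(x [^] j) [^] ord x = \<one>"
          using x(1) by (metis int_pow_int int_pow_one int_pow_pow mult.commute pow_ord_eq_1)
        then have "ord (x [^] j) dvd ord x"
          using x(1) by (simp add: pow_eq_id)
        then have "odd (ord (x [^] j))"
          using x(2) dvd_trans by blast
        then have "x [^] j = \<one>"
          by (rule odd_ord_two_pow_trivial[OF P.subgroup_axioms P(2) xj])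
        then show ?thesis
          using sj by simp
      qed
      then show False
        using S(2,3) by blast
    qed
    then show ?thesis
      using centralized_by_odd_ord_imp_central[OF S(1) x(1) x1 x(2)] that(4,5) by blast
  qed
  have involution_commutes: "x \<otimes> t = t \<otimes> x" if t: "t \<in> P" "t \<otimes> t = \<one>" for t
  proof (cases "t = \<one>")
    case False
    then obtain N where N: "N \<lhd> G" "t \<notin> N" "\<forall>g\<in>carrier G. t \<otimes> g \<otimes> inv t \<otimes> inv g \<in> N"
      using split t Pc unfolding involutions_split_def by blast
    have NP: "N \<inter> P \<lhd> G" "N \<inter> P \<subseteq> P" "N \<inter> P \<noteq> P"
      using normal_subgroup_intersect[OF N(1) P(1)] N(2) t(1) by auto
    \<comment> \<open>This is the commutator of \<open>x\<close> and \<open>t\<close>. It lies in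
      \<open>N \<inter> P\<close>, which is central because \<open>t\<close> keeps it from being all
      of \<open>P\<close>.\<close>
    define c where "c = inv (t \<otimes> x \<otimes> inv t \<otimes> inv x)"
    have tc: "t \<in> carrier G"
      by (rule Pc[OF t(1)])
    have c': "c = x \<otimes> t \<otimes> inv x \<otimes> inv t"
      using tc x(1) by (simp add: c_def group_word)
    have "c \<in> P"
      using t(1) P.inv_op_closed2[OF x(1) t(1)] by (simp add: c')
    moreover have "c \<in> N"
      using N(3) x(1) subgroup.m_inv_closed[OF normal_imp_subgroup[OF N(1)]] by (simp add: c_def)
    ultimately have "x \<otimes> c = c \<otimes> x"
      using central[OF NP _ x(1)] by blast
    moreover have "x \<otimes> t \<otimes> inv x = c \<otimes> t"
      using tc x(1) by (simp add: c' m_assoc)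
    ultimately have "c = \<one>"
      using trivial[OF \<open>c \<in> P\<close> tc] by blast
    then show ?thesis
      using tc x(1) \<open>x \<otimes> t \<otimes> inv x = c \<otimes> t\<close> conj_eq_iff_commute[OF x(1) tc] by simp
  qed (use x(1) in simp)

  \<comment> \<open>Centrality of squares and commutators in \<open>P\<close>\<close>
  have "k \<noteq> 0"
  proof
    assume "k = 0"
    then obtain y where "P = {y}"
      using P(2) by (auto simp: card_1_singleton_iff)
    then have "P = {\<one>}"
      using P.one_closed by blast
    then show False
      using p0 x(1) by auto
  qed
  then obtain l where kl: "k = Suc l"
    by (cases k) auto
  have finP: "finite P"
    using fin P.subset by (rule finite_subset[rotated])
  then obtain M where M0: "subgroup M (G\<lparr>carrier := P\<rparr>)" "card M = 2 ^ l"
    using sylow_thm[OF two_is_prime_nat subgroup_imp_group[OF P.subgroup_axioms], of l 2] P(2) kl by (auto simp: order_def)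
  have M: "subgroup M G" "M \<subseteq> P" "card P = 2 * card M"
    using incl_subgroup[OF P.subgroup_axioms M0(1)] subgroup.subset[OF M0(1)] M0(2) P(2) kl by auto
  interpret M: subgroup M G by fact
  note half = half_subgroup_mult_iff[OF fin M(1) P.subgroup_axioms M(2,3)]
  \<comment> \<open>The core of \<open>M\<close> in \<open>G\<close>, properly contained in
    \<open>P\<close> and therefore central. Squares and commutators of \<open>P\<close> fall into it
    because \<open>M\<close> has index 2 in \<open>P\<close>.\<close>
  let ?S = "{p \<in> P. \<forall>g\<in>carrier G. g \<otimes> p \<otimes> inv g \<in> M}"
  have S: "?S \<lhd> G" "?S \<subseteq> P" "?S \<noteq> P"
  proof -
    have "subgroup ?S G"
    proof (rule subgroupI)
      show "?S \<noteq> {}"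
        using P.one_closed M.one_closed by (auto intro!: exI[of _ \<one>])
      show "inv a \<in> ?S" if "a \<in> ?S" for a
      proof -
        have "g \<otimes> inv a \<otimes> inv g = inv (g \<otimes> a \<otimes> inv g)" if "g \<in> carrier G" for g
          using that \<open>a \<in> ?S\<close> by (simp add: group_word)
        then show ?thesis
          using that by auto
      qed
      show "a \<otimes> b \<in> ?S" if "a \<in> ?S" "b \<in> ?S" for a b
      proof -
        have "g \<otimes> (a \<otimes> b) \<otimes> inv g = (g \<otimes> a \<otimes> inv g) \<otimes> (g \<otimes> b \<otimes> inv g)" if "g \<in> carrier G" for g
          using that \<open>a \<in> ?S\<close> \<open>b \<in> ?S\<close> by (simp add: group_word)
        then show ?thesis
          using that M.m_closed by auto
      qed
    qed (use Pc in auto)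
    moreover have "h \<otimes> p \<otimes> inv h \<in> ?S" if "h \<in> carrier G" "p \<in> ?S" for h p
    proof -
      have "g \<otimes> (h \<otimes> p \<otimes> inv h) \<otimes> inv g = (g \<otimes> h) \<otimes> p \<otimes> inv (g \<otimes> h)" if "g \<in> carrier G" for g
        using that \<open>h \<in> carrier G\<close> \<open>p \<in> ?S\<close> by (simp add: group_word)
      then show ?thesis
        using that P.inv_op_closed2 by auto
    qed
    ultimately show "?S \<lhd> G"
      by (auto simp: normal_inv_iff)
    have "?S \<subseteq> M"
    proof
      fix p assume "p \<in> ?S"
      then have "\<one> \<otimes> p \<otimes> inv \<one> \<in> M" "p \<in> carrier G"
        using Pc by blast+
      then show "p \<in> M"
        by simp
    qed
    moreover have "M \<noteq> P"
      using M(3) P(2) by auto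
    ultimately show "?S \<noteq> P"
      using M(2) by blast
  qed blast
  have S_central: "g \<otimes> s = s \<otimes> g" if "s \<in> ?S" "g \<in> carrier G" for s g
    by (rule central[OF S that])
  have square: "p \<otimes> p \<in> ?S" if p: "p \<in> P" for p
  proof -
    have "g \<otimes> (p \<otimes> p) \<otimes> inv g \<in> M" if g: "g \<in> carrier G" for g
    proof -
      have "g \<otimes> (p \<otimes> p) \<otimes> inv g = (g \<otimes> p \<otimes> inv g) \<otimes> (g \<otimes> p \<otimes> inv g)"
        using g Pc[OF p] by (simp add: group_word)
      then show ?thesis
        using half[of "g \<otimes> p \<otimes> inv g" "g \<otimes> p \<otimes> inv g"] P.inv_op_closed2[OF g p] by simp
    qed
    then show ?thesis
      using p by simp
  qed
  have commutator: "p \<otimes> q \<otimes> inv p \<otimes> inv q \<in> ?S" if p: "p \<in> P" and q: "q \<in> P" for p q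
  proof -
    have "g \<otimes> (p \<otimes> q \<otimes> inv p \<otimes> inv q) \<otimes> inv g \<in> M" if g: "g \<in> carrier G" for g
    proof -
      let ?p = "g \<otimes> p \<otimes> inv g" and ?q = "g \<otimes> q \<otimes> inv g"
      have pq: "?p \<in> P" "?q \<in> P"
        using P.inv_op_closed2[OF g p] P.inv_op_closed2[OF g q] .
      have inv_iff: "y \<in> M \<longleftrightarrow> inv y \<in> M" if "y \<in> P" for y
        using half[OF that P.m_inv_closed[OF that]] M.one_closed Pc[OF that] by simp
      have "g \<otimes> (p \<otimes> q \<otimes> inv p \<otimes> inv q) \<otimes> inv g = ?p \<otimes> ?q \<otimes> inv ?p \<otimes> inv ?q"
        using g Pc[OF p] Pc[OF q] by (simp add: group_word)
      also have "\<dots> \<in> M"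
        using half[OF pq] half[OF P.m_closed[OF pq] P.m_inv_closed[OF pq(1)]]
          half[OF P.m_closed[OF P.m_closed[OF pq] P.m_inv_closed[OF pq(1)]] P.m_inv_closed[OF pq(2)]]
          inv_iff[OF pq(1)] inv_iff[OF pq(2)] by argo
      finally show ?thesis .
    qed
    then show ?thesis
      using p q by simp
  qed

  \<comment> \<open>Construction of the quaternion generators\<close>
  define h0 where "h0 = x \<otimes> p0 \<otimes> inv x"
  \<comment> \<open>This is the commutator of \<open>p0\<close> and \<open>x\<close>; unlike
    \<open>p0\<close> itself, it is certain to have a square of order at most 2.\<close>
  define i where "i = p0 \<otimes> inv h0"
  have p0c: "p0 \<in> carrier G"
    by (rule Pc[OF p0(1)])
  have h0: "h0 \<in> P"
    unfolding h0_def by (rule P.inv_op_closed2[OF x(1) p0(1)])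
  have h0c: "h0 \<in> carrier G"
    by (rule Pc[OF h0])
  have i: "i \<in> P"
    using p0(1) h0 by (simp add: i_def)
  have ic: "i \<in> carrier G"
    by (rule Pc[OF i])
  have xi: "x \<otimes> i \<noteq> i \<otimes> x"
  proof
    assume xi: "x \<otimes> i = i \<otimes> x"
    have "x \<otimes> inv i = inv i \<otimes> x"
      using commute_inv[OF ic x(1) xi[symmetric]] by simp
    moreover have h: "x \<otimes> p0 \<otimes> inv x = inv i \<otimes> p0"
      using p0c h0c by (simp add: i_def group_word flip: h0_def)
    ultimately have "inv i = \<one>"
      using trivial[OF P.m_inv_closed[OF i] p0c] by blast
    then show False
      using h conj_eq_iff_commute[OF x(1) p0c] p0 p0c by simp
  qed
  \<comment> \<open>As \<open>p0 \<otimes> p0\<close> is central, it equals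
    \<open>h0 \<otimes> h0\<close>. Therefore \<open>i \<otimes> i\<close> reduces to the commutator
    of \<open>p0\<close> and \<open>inv h0\<close>, which has trivial square.\<close>
  have ii_sq: "(i \<otimes> i) \<otimes> (i \<otimes> i) = \<one>"
  proof -
    let ?h = "inv h0"
    define c where "c = p0 \<otimes> ?h \<otimes> inv p0 \<otimes> inv ?h"
    have c: "c \<in> ?S" "c \<in> carrier G"
      using commutator[OF p0(1) P.m_inv_closed[OF h0]] p0c h0c by (simp_all add: c_def)
    have gh: "p0 \<otimes> ?h = c \<otimes> (?h \<otimes> p0)"
      using p0c h0c by (simp add: c_def group_word)
    have pp: "g \<otimes> (p0 \<otimes> p0) = (p0 \<otimes> p0) \<otimes> g" if "g \<in> carrier G" for g
      by (rule S_central[OF square[OF p0(1)] that])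
    have "h0 \<otimes> h0 = x \<otimes> (p0 \<otimes> p0) \<otimes> inv x"
      using x(1) p0c by (simp add: h0_def group_word)
    also have "\<dots> = p0 \<otimes> p0"
      using pp[OF x(1)] x(1) p0c by (simp add: m_assoc)
    finally have hh: "h0 \<otimes> h0 = p0 \<otimes> p0" .
    have "c \<otimes> c = \<one>"
      by (rule commutator_square_trivial[OF p0c _ c(2) gh S_central[OF c(1) p0c] pp[symmetric]])
        (use h0c in simp_all)
    moreover have "i \<otimes> i = c"
    proof -
      have "i \<otimes> i = c \<otimes> (?h \<otimes> p0) \<otimes> (p0 \<otimes> ?h)"
        using gh by (simp add: i_def)
      also have "\<dots> = c \<otimes> (?h \<otimes> (p0 \<otimes> p0) \<otimes> ?h)"
        using p0c h0c c(2) by (simp add: m_assoc)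
      also have "\<dots> = c"
        using h0c c(2) by (simp add: group_word flip: hh)
      finally show ?thesis .
    qed
    ultimately show ?thesis
      by simp
  qed
  define j where "j = x \<otimes> i \<otimes> inv x"
  define s where "s = i \<otimes> i"
  have j: "j \<in> P"
    unfolding j_def by (rule P.inv_op_closed2[OF x(1) i])
  have jc: "j \<in> carrier G"
    by (rule Pc[OF j])
  have s: "s \<in> ?S" "s \<in> carrier G" "s \<otimes> s = \<one>"
    using square[OF i] ic ii_sq by (simp_all add: s_def)
  have s1: "s \<noteq> \<one>"
    using involution_commutes[OF i] xi by (auto simp: s_def)
  have jj: "j \<otimes> j = s"
  proof -
    have "j \<otimes> j = x \<otimes> s \<otimes> inv x"
      using x(1) ic by (simp add: j_def s_def group_word)
    then show ?thesis
      using S_central[OF s(1) x(1)] s(2) x(1) by (simp add: m_assoc)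
  qed
  define z where "z = i \<otimes> j \<otimes> inv i \<otimes> inv j"
  have z: "z \<in> ?S" "z \<in> carrier G"
    using commutator[OF i j] ic jc by (simp_all add: z_def)
  have ij: "i \<otimes> j = z \<otimes> (j \<otimes> i)"
    using ic jc by (simp add: z_def group_word)
  have zz: "z \<otimes> z = \<one>"
    by (rule commutator_square_trivial[OF ic jc z(2) ij S_central[OF z(1) ic]
          S_central[OF s(1) jc, unfolded s_def, symmetric]])
  \<comment> \<open>If \<open>i\<close> and \<open>j\<close> commuted,
    \<open>j \<otimes> inv i\<close> would have trivial square and so commute with \<open>x\<close>.
    As it is the factor by which \<open>x\<close> moves \<open>i\<close>, it would be trivial, and
    \<open>x\<close> would commute with \<open>i\<close>.\<close>
  have z1: "z \<noteq> \<one>"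
  proof
    assume "z = \<one>"
    then have ij: "i \<otimes> j = j \<otimes> i"
      using ij ic jc by simp
    let ?c = "j \<otimes> inv i"
    have c: "?c \<in> P"
      using i j by simp
    have "?c \<otimes> ?c = \<one>"
    proof -
      have "inv i \<otimes> j = j \<otimes> inv i"
        by (rule commute_inv[OF ic jc ij])
      then have "?c \<otimes> ?c = (j \<otimes> j) \<otimes> inv (i \<otimes> i)"
        using ic jc by (simp add: m_assoc inv_mult_group) (simp flip: m_assoc)
      then show ?thesis
        using s(2) by (simp add: jj s_def[symmetric])
    qed
    then have xc: "x \<otimes> ?c = ?c \<otimes> x"
      using involution_commutes[OF c] by blast
    have xix: "x \<otimes> i \<otimes> inv x = ?c \<otimes> i"
      using ic jc by (simp add: m_assoc flip: j_def)
    then have "?c = \<one>"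
      by (rule trivial[OF c ic xc])
    then show False
      using xix conj_eq_iff_commute[OF x(1) ic] xi ic by simp
  qed
  have inv_s: "inv s = s" and inv_z: "inv z = z"
    using s z zz by (simp_all add: inv_equality)
  have sz: "s \<otimes> z = z \<otimes> s"
    using S_central[OF z(1) s(2)] .

  \<comment> \<open>The quaternion section\<close>
  define w where "w = s \<otimes> z"
  have w: "w \<in> carrier G"
    using s z by (simp add: w_def)
  have ww: "w \<otimes> w = \<one>"
  proof -
    have "w \<otimes> w = s \<otimes> (z \<otimes> s) \<otimes> z"
      using s(2) z(2) by (simp add: w_def m_assoc)
    also have "\<dots> = (s \<otimes> s) \<otimes> (z \<otimes> z)"
      using s(2) z(2) by (simp add: m_assoc flip: sz)
    finally show ?thesis
      using s(3) zz by simp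
  qed
  have w_central: "g \<otimes> w \<otimes> inv g = w" if "g \<in> carrier G" for g
  proof -
    have "g \<otimes> w = (g \<otimes> s) \<otimes> z"
      using that s(2) z(2) by (simp add: w_def m_assoc)
    also have "\<dots> = s \<otimes> (g \<otimes> z)"
      using that s(2) z(2) by (simp add: S_central[OF s(1) that] m_assoc)
    also have "\<dots> = w \<otimes> g"
      using that s(2) z(2) by (simp add: S_central[OF z(1) that] w_def m_assoc)
    finally show ?thesis
      by (rule conj_eq_iff_commute[OF that w, THEN iffD2])
  qed
  have inv_w: "inv w = w"
    using w ww by (simp add: inv_equality)
  have B: "subgroup {\<one>, w} G"
    by (rule subgroupI) (use w ww inv_w in auto)
  \<comment> \<open>Modulo \<open>w\<close> the commutator \<open>z\<close> is identified with
    \<open>s\<close>, which turns the relations of \<open>i\<close> and \<open>j\<close> into those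
    of the quaternion group.\<close>
  have "i \<otimes> i \<in> {\<one>, w}"
  proof (rule Q8[unfolded no_Q8_section_relations_def, rule_format, OF subgroup_self B _ _ ic jc])
    show "i \<otimes> i \<otimes> inv (j \<otimes> j) \<in> {\<one>, w}"
      using s(2) by (simp add: jj s_def[symmetric])
    have "i \<otimes> j \<otimes> i \<otimes> inv j = z \<otimes> (j \<otimes> s) \<otimes> inv j"
      using ic jc z(2) by (simp add: ij s_def m_assoc)
    also have "\<dots> = w"
      using jc s(2) z(2) by (simp add: S_central[OF s(1) jc] m_assoc w_def sz)
    finally show "i \<otimes> j \<otimes> i \<otimes> inv j \<in> {\<one>, w}"
      by simp
  qed (use w w_central in auto)
  then have "s = s \<otimes> z"
    using s1 by (simp add: s_def[symmetric] w_def)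
  then show False
    using z1 s(2) z(2) by simp
qed

text \<open>Induction on the order. Proper subgroups, with restricted carrier, and quotients by odd
  normal subgroups, on representatives, have the type of \<open>G\<close>, so a counterexample of
  least order satisfies the locale assumptions.\<close>

lemma involutions_split_imp_two_nilpotent:
  fixes G :: "('a, 'b) monoid_scheme"
  assumes "group G" "finite (carrier G)" "no_Q8_section_relations G" "involutions_split G"
  shows "p_nilpotent 2 G"
  using assms
proof (induct "order G" arbitrary: G rule: less_induct)
  case less
  interpret group G by fact
  note fin = \<open>finite (carrier G)\<close>
  show ?case
  proof (rule ccontr)
    assume not_nilp: "\<not> p_nilpotent 2 G"
    have "minimal_non_two_nilpotent G"
    proof
      show "finite (carrier G)"
        by (rule fin)
      show "\<exists>K. normal_two_complement G H K" if H: "subgroup H G" "H \<noteq> carrier G" for H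
      proof -
        have "card H < card (carrier G)"
          using H fin subgroup.subset[OF H(1)] by (intro psubset_card_mono) auto
        then have "p_nilpotent 2 (G\<lparr>carrier := H\<rparr>)"
          using fin subgroup.subset[OF H(1)] finite_subset
          by (intro less.hyps subgroup_imp_group H no_Q8_section_relations_subgroup involutions_split_subgroup less.prems)
            (auto simp: order_def)
        then show ?thesis
          using p_nilpotent_two_subgroup_iff[OF fin H(1)] by simp
      qed
      show "\<not> normal_two_complement G (carrier G) K" for K
        using not_nilp p_nilpotent_two_iff[OF fin] by blast
      show "N = {\<one>\<^bsub>G\<^esub>}" if N: "N \<lhd> G" "odd (card N)" for N
      proof (rule ccontr)
        assume "N \<noteq> {\<one>\<^bsub>G\<^esub>}"
        obtain Q :: "('a, 'b) monoid_scheme" and f :: "'a \<Rightarrow> 'a"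
          where f: "group_hom G Q f" "f ` carrier G = carrier Q" "kernel G Q f = N"
          by (rule quotient_on_representatives[OF N(1)])
        interpret f: group_hom G Q f by fact
        have finN: "finite N"
          using N(2) by (rule card_ge_0_finite[OF odd_pos])
        have "{\<one>\<^bsub>G\<^esub>} \<subset> N"
          using \<open>N \<noteq> {\<one>\<^bsub>G\<^esub>}\<close> subgroup.one_closed[OF normal_imp_subgroup[OF N(1)]] by blast
        then have "card N > 1"
          using psubset_card_mono[OF finN, of "{\<one>\<^bsub>G\<^esub>}"] by simp
        moreover have "order G = order Q * card N"
        proof -
          have "{g \<in> carrier G. f g \<in> carrier Q} = carrier G"
            by auto
          then show ?thesis
            using f.card_vimage_kernel[OF fin, of "carrier Q"] f(2,3) by (simp add: order_def)
        qed
        moreover have "order G > 0"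
          using fin by (simp add: order_gt_0_iff_finite)
        ultimately have "order Q < order G"
          by simp
        moreover have "finite (carrier Q)"
          using fin by (simp flip: f(2))
        ultimately have "p_nilpotent 2 Q"
          using less.hyps[of Q] f.H.is_group f.no_Q8_section_relations_image[OF f(2)]
            f.involutions_split_image[OF f(2)] f(3) N(2) less.prems by simp
        then show False
          using f.p_nilpotent_two_if_image[OF fin f(2)] f(3) N(2) not_nilp by simp
      qed
    qed
    then show False
      by (rule minimal_non_two_nilpotent.not_involutions_split_without_Q8_section) (use less.prems in simp_all)
  qed
qed

theorem theorem1p2:
  fixes G :: "('a, 'b) monoid_scheme"
  assumes "group G"
    and "finite (carrier G)"
    and "Q8_free G"
    and "\<And>H. subgroup H G \<Longrightarrow> card H = 2 \<Longrightarrow> ic_phi_subgroup H G"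
  shows "p_nilpotent 2 G"
  by (rule involutions_split_imp_two_nilpotent[OF assms(1,2) group.Q8_free_imp_no_Q8_section_relations[OF assms(1,3)]
        group.ic_phi_imp_involutions_split[OF assms(1,4)]])

end
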